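(* Let $p\ge 1$ and let $(X_{n,k})$ be the triangular AR$(p)$ process with parameters $\theta_n$, companion matrices $A_n$ and i.i.d. zero-mean noise $(\varepsilon_k)$ described in the context, with $\mathbb{E}[\varepsilon_1^2]=\sigma^2<+\infty$. Assume that: (i) there is a $p\times p$ matrix $A$ with $A_n\to A$, whose eigenvalues are distinct and satisfy $0<|\lambda_p|\le\dots\le|\lambda_2|\le|\lambda_1|=\rho(A)=1$, and whose top-right entry is non-zero; (ii) $A$ has exactly one unit root: $\lambda_1\in\{-1,1\}$ and, if $p\ge 2$, $|\lambda_2|<1$; (iii) $\rho(A_n)=1-\frac{c}{v_n}$ for some $c>0$ and some sequence $(v_n)$ with $v_n\to+\infty$ and $v_n/n\to 0$. Then the ordinary least squares estimator $\widehat\theta_n$ of $\theta_n$ satisfies $$\big\Vert\widehat\theta_n-\theta_n\big\Vert\ \overset{p}{\longrightarrow}\ 0\qquad (n\to+\infty).$$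
   Context: Process: $(\varepsilon_k)$ is a sequence of i.i.d. real random variables with mean $0$ and variance $\sigma^2>0$. For each $n\ge1$, $\theta_n=(\theta_{n,1},\dots,\theta_{n,p})^T\in\mathbb{R}^p$ and, for $1\le k\le n$, $X_{n,k}=\sum_{i=1}^p\theta_{n,i}X_{n,k-i}+\varepsilon_k$. Put $\Phi_{n,k}=(X_{n,k},\dots,X_{n,k-p+1})^T$, $E_k=(\varepsilon_k,0,\dots,0)^T\in\mathbb{R}^p$. Then $\Phi_{n,k}=A_n\Phi_{n,k-1}+E_k$, where $A_n=\begin{pmatrix}\theta_{n,1}\ \cdots\ \theta_{n,p-1} & \theta_{n,p}\\ I_{p-1} & 0\end{pmatrix}$ is the $p\times p$ companion matrix ($A_n=\theta_{n,1}$ if $p=1$). The initial vector $\Phi_{n,0}$ has a finite moment of order 2 and is independent of $(E_k)$. OLS estimator: $\widehat\theta_n=S_{n,n-1}^{-1}\sum_{k=1}^n\Phi_{n,k-1}X_{n,k}$ with $S_{n,n-1}=\sum_{k=0}^{n-1}\Phi_{n,k}\Phi_{n,k}^T$ (a small $\epsilon>0$ may be added to $S_{n,n-1}$ to avoid an invertibility assumption, without disturbing the asymptotic behavior). $\rho(\cdot)$ is the spectral radius; $\lambda_1,\dots,\lambda_p\in\mathbb{C}$ are the eigenvalues of $A$, sorted by modulus in descending order with ties broken by descending lexicographic order; $\Vert\cdot\Vert$ is the Euclidean norm; $\overset{p}{\longrightarrow}$ denotes convergence in probability. *)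

theory Defs
  imports "HOL-Probability.Probability" "Jordan_Normal_Form.Spectral_Radius"
begin

definition eucl_norm :: "real vec \<Rightarrow> real" where
  "eucl_norm v = sqrt (\<Sum>i<dim_vec v. (v $ i)\<^sup>2)"

text \<open>
  Vectors and matrices are indexed from \<open>0\<close>: the \<open>i\<close>-th autoregressive coefficient
  is \<open>\<theta> $ (i - 1)\<close>, and the top right entry of a \<open>p \<times> p\<close> matrix has index \<open>(0, p - 1)\<close>.
\<close>

definition companion_mat :: "nat \<Rightarrow> real vec \<Rightarrow> real mat" where
  "companion_mat p \<theta> =
     mat p p (\<lambda>(i, j). if i = 0 then \<theta> $ j else if i = j + 1 then 1 else 0)"

abbreviation complex_mat :: "real mat \<Rightarrow> complex mat" where
  "complex_mat \<equiv> map_mat complex_of_real"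

definition mat_tendsto :: "nat \<Rightarrow> (nat \<Rightarrow> real mat) \<Rightarrow> real mat \<Rightarrow> bool" where
  "mat_tendsto p B A \<longleftrightarrow> (\<forall>i<p. \<forall>j<p. (\<lambda>n. B n $$ (i, j)) \<longlonglongrightarrow> A $$ (i, j))"

text \<open>Descending order by modulus, ties broken by the descending lexicographic order on \<open>(Re, Im)\<close>.\<close>

definition eigenvalue_ge :: "complex \<Rightarrow> complex \<Rightarrow> bool" where
  "eigenvalue_ge z w \<longleftrightarrow> cmod z > cmod w \<or>
     cmod z = cmod w \<and> (Re z > Re w \<or> Re z = Re w \<and> Im z \<ge> Im w)"

text \<open>\<open>lam 1, \<dots>, lam p\<close> are the eigenvalues, repeated according to algebraic multiplicity.\<close>

definition sorted_eigenvalues :: "nat \<Rightarrow> complex mat \<Rightarrow> (nat \<Rightarrow> complex) \<Rightarrow> bool" where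
  "sorted_eigenvalues p A lam \<longleftrightarrow>
     char_poly A = (\<Prod>i\<in>{1..p}. [:- lam i, 1:]) \<and>
     (\<forall>i\<in>{1..p}. \<forall>j\<in>{1..p}. i < j \<longrightarrow> eigenvalue_ge (lam i) (lam j))"

definition tendsto_in_prob ::
    "'w measure \<Rightarrow> (nat \<Rightarrow> 'w \<Rightarrow> real) \<Rightarrow> real \<Rightarrow> bool" where
  "tendsto_in_prob M Y y \<longleftrightarrow>
     (\<forall>\<delta>>0. (\<lambda>n. measure M {\<omega> \<in> space M. \<bar>Y n \<omega> - y\<bar> > \<delta>}) \<longlonglongrightarrow> 0)"

text \<open>
  A path is a function on the integers; its values at \<open>1 - p, \<dots>, 0\<close> form the initial vector.
  The vector \<open>lag_vec p x k\<close> is \<open>(x k, x (k - 1), \<dots>, x (k - p + 1))\<close>.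
\<close>

definition lag_vec :: "nat \<Rightarrow> (int \<Rightarrow> real) \<Rightarrow> int \<Rightarrow> real vec" where
  "lag_vec p x k = vec p (\<lambda>i. x (k - int i))"

definition gram_mat :: "nat \<Rightarrow> (int \<Rightarrow> real) \<Rightarrow> nat \<Rightarrow> real mat" where
  "gram_mat p x n =
     mat p p (\<lambda>(i, j). \<Sum>k=0..<n. lag_vec p x (int k) $ i * lag_vec p x (int k) $ j)"

definition cross_vec :: "nat \<Rightarrow> (int \<Rightarrow> real) \<Rightarrow> nat \<Rightarrow> real vec" where
  "cross_vec p x n =
     vec p (\<lambda>i. \<Sum>k=1..n. lag_vec p x (int k - 1) $ i * x (int k))"

text \<open>If the Gram matrix is singular, the estimator is set to \<open>0\<close> by convention.\<close>

definition ols_estimator :: "nat \<Rightarrow> (int \<Rightarrow> real) \<Rightarrow> nat \<Rightarrow> real vec" where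
  "ols_estimator p x n =
     (case mat_inverse (gram_mat p x n) of
        Some B \<Rightarrow> B *\<^sub>v cross_vec p x n
      | None \<Rightarrow> 0\<^sub>v p)"

text \<open>
  In row \<open>n \<ge> 1\<close> only the values \<open>X n k\<close> with \<open>1 - p \<le> k \<le> n\<close> matter, and of the noise only
  \<open>\<epsilon> 1, \<epsilon> 2, \<dots>\<close>. Independence is between the initial vector of each row and the whole noise
  sequence; both are encoded as (extensional) functions so that they have the same type.
  Nothing is assumed uniformly in \<open>n\<close> or jointly over the rows about the initial vectors.
\<close>

locale triangular_ar = prob_space M
  for M :: "'w measure" +
  fixes p :: nat
    and \<theta> :: "nat \<Rightarrow> real vec"
    and \<epsilon> :: "nat \<Rightarrow> 'w \<Rightarrow> real"
    and \<sigma> :: real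
    and X :: "nat \<Rightarrow> int \<Rightarrow> 'w \<Rightarrow> real"
  assumes p_ge_1: "p \<ge> 1"
    and theta_carrier: "n \<ge> 1 \<Longrightarrow> \<theta> n \<in> carrier_vec p"
    and noise_indep: "indep_vars (\<lambda>_. borel) \<epsilon> {1..}"
    and noise_ident: "k \<ge> 1 \<Longrightarrow> distr M borel (\<epsilon> k) = distr M borel (\<epsilon> 1)"
    and noise_integrable: "integrable M (\<epsilon> 1)"
    and noise_square_integrable: "integrable M (\<lambda>\<omega>. (\<epsilon> 1 \<omega>)\<^sup>2)"
    and noise_mean: "expectation (\<epsilon> 1) = 0"
    and noise_second_moment: "expectation (\<lambda>\<omega>. (\<epsilon> 1 \<omega>)\<^sup>2) = \<sigma>\<^sup>2"
    and sigma_pos: "\<sigma> > 0"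
    and init_square_integrable:
      "n \<ge> 1 \<Longrightarrow> integrable M (\<lambda>\<omega>. (eucl_norm (lag_vec p (\<lambda>k. X n k \<omega>) 0))\<^sup>2)"
    and init_indep:
      "n \<ge> 1 \<Longrightarrow> indep_var
         (\<Pi>\<^sub>M i\<in>{..<p}. borel) (\<lambda>\<omega>. \<lambda>i\<in>{..<p}. lag_vec p (\<lambda>k. X n k \<omega>) 0 $ i)
         (\<Pi>\<^sub>M k\<in>{1..}. borel) (\<lambda>\<omega>. \<lambda>k\<in>{1..}. \<epsilon> k \<omega>)"
    and ar_equation:
      "n \<ge> 1 \<Longrightarrow> 1 \<le> k \<Longrightarrow> k \<le> n \<Longrightarrow> \<omega> \<in> space M \<Longrightarrow>
         X n (int k) \<omega> = (\<Sum>i=1..p. \<theta> n $ (i - 1) * X n (int k - int i) \<omega>) + \<epsilon> k \<omega>"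
begin

lemma companion_equation:
  assumes n: "n \<ge> 1" and k: "1 \<le> k" "k \<le> n" and w: "\<omega> \<in> space M"
  shows "lag_vec p (\<lambda>k. X n k \<omega>) (int k) =
           companion_mat p (\<theta> n) *\<^sub>v lag_vec p (\<lambda>k. X n k \<omega>) (int k - 1)
           + vec p (\<lambda>i. if i = 0 then \<epsilon> k \<omega> else 0)"
proof (rule eq_vecI)
  fix i
  assume "i < dim_vec (companion_mat p (\<theta> n) *\<^sub>v lag_vec p (\<lambda>k. X n k \<omega>) (int k - 1)
           + vec p (\<lambda>i. if i = 0 then \<epsilon> k \<omega> else 0))"
  hence i: "i < p" by simp
  show "lag_vec p (\<lambda>k. X n k \<omega>) (int k) $ i =
          (companion_mat p (\<theta> n) *\<^sub>v lag_vec p (\<lambda>k. X n k \<omega>) (int k - 1)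
           + vec p (\<lambda>i. if i = 0 then \<epsilon> k \<omega> else 0)) $ i"
  proof (cases i)
    case 0
    have "(\<Sum>i=1..p. \<theta> n $ (i - 1) * X n (int k - int i) \<omega>) =
            (\<Sum>j=0..<p. \<theta> n $ j * X n (int k - 1 - int j) \<omega>)"
      by (rule sum.reindex_bij_witness[of _ Suc "\<lambda>i. i - 1"])
         (auto simp: of_nat_diff algebra_simps)
    with 0 i ar_equation[OF n k w] show ?thesis
      by (simp add: lag_vec_def companion_mat_def scalar_prod_def)
  next
    case (Suc l)
    have "(\<Sum>j=0..<p. (if i = j + 1 then 1 else 0) * X n (int k - 1 - int j) \<omega>) =
            (\<Sum>j=0..<p. if j = l then X n (int k - 1 - int j) \<omega> else 0)"
      by (rule sum.cong) (auto simp: Suc)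
    also have "\<dots> = X n (int k - 1 - int l) \<omega>"
      using i Suc by simp
    finally show ?thesis
      using i Suc by (simp add: lag_vec_def companion_mat_def scalar_prod_def algebra_simps)
  qed
qed (simp_all add: lag_vec_def companion_mat_def)

end

end

theory Submission
  imports Defs "HOL-Computational_Algebra.Polynomial_FPS"
begin

unbundle no vec_syntax

text \<open>
  Write \<open>\<delta>\<close> for the estimation error and \<open>y\<^sub>k = \<delta> \<bullet> \<Phi>\<^sub>k\<close>. The normal equations give
  \<open>\<Sum> y\<^sub>k\<^sup>2 = \<Sum> \<epsilon>\<^sub>k\<^sub>+\<^sub>1 y\<^sub>k\<close>.

  Lower bound: the autoregressive filter turns \<open>y\<close> into the moving average \<open>\<Sum>i. \<delta>\<^sub>i \<epsilon>\<^sub>k\<^sub>-\<^sub>i\<close>, whose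
  energy is at least a multiple of \<open>n \<parallel>\<delta>\<parallel>\<^sup>2\<close> with high probability. The filter being bounded,
  \<open>\<Sum> y\<^sub>k\<^sup>2\<close> has such a lower bound as well.

  Upper bound: split the process into its response \<open>w\<close> to the noise from zero initial values and a
  solution of the homogeneous recursion. The latter lives in a deterministic space of dimension at
  most \<open>p\<^sup>2\<close>, onto which the noise has a bounded projection, uniformly in the initial vectors. The
  contribution of \<open>w\<close> is \<open>o(n)\<close> as soon as \<open>\<Sum>j<n. h\<^sub>j\<^sup>2 = o(n)\<close> for the impulse response \<open>h\<close>,
  whose generating function is the inverse of \<open>1 - \<Sum> \<theta>\<^sub>i z\<^sup>i\<close>.

  Impulse response: some root \<open>\<mu>\<^sub>n\<close> of the characteristic polynomial tends to \<open>\<lambda>\<^sub>1\<close>, and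
  \<open>\<bar>\<mu>\<^sub>n\<bar> \<le> 1 - c / v\<^sub>n\<close>. The cofactor of \<open>1 - \<mu>\<^sub>n z\<close> converges to the product of the
  \<open>1 - \<lambda>\<^sub>i z\<close> with \<open>i \<ge> 2\<close>, so by perturbation its inverse is bounded in \<open>\<ell>\<^sup>1\<close>. This gives
  \<open>\<Sum> h\<^sub>j\<^sup>2 = O(v\<^sub>n)\<close>, and \<open>v\<^sub>n = o(n)\<close>.
\<close>

section \<open>Power series with bounded coefficient sums\<close>

text \<open>Partial sums stand in for the l^1 norm: they are finite for every series, so no
  summability has to be established, and a bound uniform in \<open>N\<close> is a bound in
  l^1.\<close>

definition fps_l1 :: "nat \<Rightarrow> 'a::real_normed_field fps \<Rightarrow> real" where
  "fps_l1 N f = (\<Sum>j\<le>N. norm (fps_nth f j))"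

lemma fps_l1_nonneg: "0 \<le> fps_l1 N f"
  by (simp add: fps_l1_def sum_nonneg)

lemma fps_l1_add: "fps_l1 N (f + g) \<le> fps_l1 N f + fps_l1 N g"
  unfolding fps_l1_def sum.distrib[symmetric] by (rule sum_mono) (simp add: norm_triangle_ineq)

lemma fps_l1_minus_commute: "fps_l1 N (f - g) = fps_l1 N (g - f)"
  unfolding fps_l1_def by (simp add: norm_minus_commute)

text \<open>The coefficients of the product up to \<open>N\<close> involve only index pairs with
  \<open>i + j \<le> N\<close>, a triangle inside the square over which the product of the two
  partial sums runs.\<close>

lemma fps_l1_mult: "fps_l1 N (f * g) \<le> fps_l1 N f * fps_l1 N g"
proof -
  have "fps_l1 N (f * g) \<le> (\<Sum>n\<le>N. \<Sum>i=0..n. norm (fps_nth f i) * norm (fps_nth g (n - i)))"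
    unfolding fps_l1_def by (rule sum_mono) (simp add: fps_mult_nth sum_norm_le norm_mult)
  also have "\<dots> = (\<Sum>n\<le>N. \<Sum>i\<le>n. norm (fps_nth f i) * norm (fps_nth g (n - i)))"
    by (simp add: atMost_atLeast0)
  also have "\<dots> = (\<Sum>(i, j)\<in>{(i, j). i + j \<le> N}. norm (fps_nth f i) * norm (fps_nth g j))"
    by (rule sum.triangle_reindex_eq[symmetric])
  also have "\<dots> \<le> (\<Sum>(i, j)\<in>{..N} \<times> {..N}. norm (fps_nth f i) * norm (fps_nth g j))"
    by (rule sum_mono2) auto
  also have "\<dots> = fps_l1 N f * fps_l1 N g"
    by (simp add: fps_l1_def sum_product sum.cartesian_product)
  finally show ?thesis .
qed

definition geom_fps :: "'a::real_normed_field \<Rightarrow> 'a fps" where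
  "geom_fps m = Abs_fps (\<lambda>j. m ^ j)"

lemma geom_fps_inverse: "(1 - fps_const m * fps_X) * geom_fps m = 1"
proof (rule fps_ext)
  fix n show "fps_nth ((1 - fps_const m * fps_X) * geom_fps m) n = fps_nth 1 n"
    by (cases n) (simp_all add: geom_fps_def algebra_simps)
qed

lemma geom_fps_l1:
  assumes "norm m < 1" shows "fps_l1 N (geom_fps m) \<le> 1 / (1 - norm m)"
proof -
  have "(\<Sum>j\<le>N. norm m ^ j) = (1 - norm m ^ Suc N) / (1 - norm m)"
    using assms sum_gp0[of "norm m" N] by simp
  also have "\<dots> \<le> 1 / (1 - norm m)"
    using assms by (intro divide_right_mono) auto
  finally show ?thesis by (simp add: fps_l1_def geom_fps_def norm_power)
qed

text \<open>Each geometric factor costs at most \<open>1 / (1 - norm (m i))\<close>, whatever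
  \<open>N\<close> is. This serves for the inverse of the stable part of the limit
  polynomial.\<close>

lemma fps_prod_geom_l1:
  fixes m :: "'i \<Rightarrow> 'a::real_normed_field"
  assumes "finite I" "\<And>i. i \<in> I \<Longrightarrow> norm (m i) < 1"
  obtains G where "\<And>N. fps_l1 N (\<Prod>i\<in>I. geom_fps (m i)) \<le> G"
proof -
  have "\<exists>G. \<forall>N. fps_l1 N (\<Prod>i\<in>I. geom_fps (m i)) \<le> G"
    using assms
  proof (induction I)
    case empty
    have "fps_l1 N (1 :: 'a fps) \<le> 1" for N
      by (simp add: fps_l1_def if_distrib cong: if_cong)
    then show ?case by auto
  next
    case (insert a I)
    then obtain G where G: "\<And>N. fps_l1 N (\<Prod>i\<in>I. geom_fps (m i)) \<le> G" by auto
    have "fps_l1 N (\<Prod>i\<in>insert a I. geom_fps (m i)) \<le> 1 / (1 - norm (m a)) * G" for N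
    proof -
      have "fps_l1 N (\<Prod>i\<in>insert a I. geom_fps (m i))
          \<le> fps_l1 N (geom_fps (m a)) * fps_l1 N (\<Prod>i\<in>I. geom_fps (m i))"
        using insert by (simp add: fps_l1_mult)
      also have "\<dots> \<le> 1 / (1 - norm (m a)) * G"
        using insert geom_fps_l1[of "m a" N] G[of N]
        by (intro mult_mono) (auto simp: fps_l1_nonneg less_imp_le)
      finally show ?thesis .
    qed
    then show ?case by blast
  qed
  then show ?thesis using that by blast
qed

text \<open>In the resolvent identity \<open>g' = g + g * (q - q') * g'\<close> the last term
  contributes at most half of \<open>fps_l1 N g'\<close> and is absorbed on the left. No prior bound
  on \<open>g'\<close> is involved, since a partial sum is always finite.\<close>

lemma fps_l1_inverse_perturb:
  assumes "q * g = 1" "q' * g' = 1"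
    and G: "fps_l1 N g \<le> G" and small: "fps_l1 N (q' - q) * G \<le> 1 / 2"
  shows "fps_l1 N g' \<le> 2 * G"
proof -
  have "g * (q - q') * g' = g' * (q * g) - g * (q' * g')"
    by (simp add: algebra_simps)
  then have "g' = g + g * (q - q') * g'"
    using assms by simp
  then have "fps_l1 N g' \<le> fps_l1 N g + fps_l1 N (g * (q - q') * g')"
    by (metis fps_l1_add)
  also have "fps_l1 N (g * (q - q') * g') \<le> fps_l1 N (g * (q - q')) * fps_l1 N g'"
    by (rule fps_l1_mult)
  also have "\<dots> \<le> (fps_l1 N g * fps_l1 N (q - q')) * fps_l1 N g'"
    by (intro mult_right_mono fps_l1_mult fps_l1_nonneg)
  also have "\<dots> \<le> (G * fps_l1 N (q - q')) * fps_l1 N g'"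
    using G by (intro mult_right_mono fps_l1_nonneg)
  also have "\<dots> \<le> 1/2 * fps_l1 N g'"
    using small by (intro mult_right_mono fps_l1_nonneg) (simp add: fps_l1_minus_commute mult.commute)
  finally show ?thesis using G by simp
qed

lemma geom_mult_square_sum:
  assumes g: "\<And>N. fps_l1 N g \<le> G" and m: "norm m < 1"
  shows "(\<Sum>j<n. (norm (fps_nth (geom_fps m * g) j))\<^sup>2) \<le> G\<^sup>2 / (1 - norm m)"
proof -
  have G0: "0 \<le> G" using g fps_l1_nonneg order_trans by blast
  \<comment> \<open>\<open>\<ell>\<^sup>2\<close> is bounded by \<open>\<ell>\<^sup>\<infinity>\<close> times \<open>\<ell>\<^sup>1\<close>, which loses nothing in the order in \<open>1 - norm m\<close>.\<close>
  have b: "norm (fps_nth (geom_fps m * g) j) \<le> G" for j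
  proof -
    have "norm (fps_nth (geom_fps m * g) j) \<le> (\<Sum>i=0..j. norm (m ^ (j - i)) * norm (fps_nth g i))"
      by (subst mult.commute)
        (simp add: fps_mult_nth geom_fps_def norm_mult sum_norm_le mult.commute)
    also have "\<dots> \<le> (\<Sum>i=0..j. 1 * norm (fps_nth g i))"
      using m by (intro sum_mono mult_right_mono) (auto simp: norm_power power_le_one)
    also have "\<dots> \<le> G" using g[of j] by (simp add: fps_l1_def atMost_atLeast0)
    finally show ?thesis .
  qed
  have "(\<Sum>j<n. (norm (fps_nth (geom_fps m * g) j))\<^sup>2)
      \<le> (\<Sum>j<n. G * norm (fps_nth (geom_fps m * g) j))"
    unfolding power2_eq_square using b by (intro sum_mono mult_right_mono) auto
  also have "\<dots> \<le> (\<Sum>j\<le>n. G * norm (fps_nth (geom_fps m * g) j))"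
    using G0 by (intro sum_mono2) auto
  also have "\<dots> = G * fps_l1 n (geom_fps m * g)" by (simp add: fps_l1_def sum_distrib_left)
  also have "\<dots> \<le> G * (fps_l1 n (geom_fps m) * fps_l1 n g)"
    using G0 by (intro mult_left_mono fps_l1_mult)
  also have "\<dots> \<le> G * (1 / (1 - norm m) * G)"
    using G0 g geom_fps_l1[OF m] m by (intro mult_left_mono mult_mono) (auto simp: fps_l1_nonneg)
  finally show ?thesis by (simp add: power2_eq_square)
qed

section \<open>The characteristic polynomial of a companion matrix\<close>

text \<open>The characteristic polynomial of the companion matrix with first row \<open>a\<close>,
  written out explicitly. It is tied to the matrix through its roots, which are the
  eigenvalues.\<close>

definition ar_poly :: "nat \<Rightarrow> (nat \<Rightarrow> real) \<Rightarrow> complex poly" where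
  "ar_poly p a = monom 1 p - (\<Sum>j<p. monom (of_real (a j)) (p - 1 - j))"

text \<open>The reversed polynomial as a power series: a root \<open>m\<close> of
  \<open>ar_poly p a\<close> becomes a factor \<open>1 - m z\<close>, and the inverse series is the
  impulse response.\<close>

definition ar_fps :: "nat \<Rightarrow> (nat \<Rightarrow> real) \<Rightarrow> complex fps" where
  "ar_fps p a = Abs_fps (\<lambda>i. if i = 0 then 1 else if i \<le> p then - of_real (a (i - 1)) else 0)"

lemma coeff_ar_poly:
  "coeff (ar_poly p a) i = (if i = p then 1 else if i < p then - of_real (a (p - 1 - i)) else 0)"
proof -
  have "(\<Sum>j<p. coeff (monom (complex_of_real (a j)) (p - 1 - j)) i)
      = (\<Sum>j<p. if j = p - 1 - i \<and> i < p then of_real (a j) else 0)"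
    by (rule sum.cong) auto
  also have "\<dots> = (if i < p then of_real (a (p - 1 - i)) else 0)"
    by (cases "i < p") auto
  finally show ?thesis by (auto simp: ar_poly_def coeff_sum)
qed

lemma degree_ar_poly: "degree (ar_poly p a) = p"
proof (rule antisym)
  show "degree (ar_poly p a) \<le> p" by (rule degree_le) (simp add: coeff_ar_poly)
  show "p \<le> degree (ar_poly p a)" by (rule le_degree) (simp add: coeff_ar_poly)
qed

lemma poly_ar_poly: "poly (ar_poly p a) z = z ^ p - (\<Sum>j<p. of_real (a j) * z ^ (p - 1 - j))"
  by (simp add: ar_poly_def poly_sum poly_monom)

lemma fps_reflect_ar_poly: "fps_of_poly (reflect_poly (ar_poly p a)) = ar_fps p a"
  by (rule fps_ext) (auto simp: ar_fps_def coeff_reflect_poly degree_ar_poly coeff_ar_poly)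

text \<open>The rows below the first force an eigenvector to be a multiple of
  \<open>(z ^ (p - 1), ..., z, 1)\<close>; for such a vector the first row is exactly the polynomial
  equation.\<close>

lemma companion_eigenvalue_iff:
  assumes p: "p \<ge> 1"
  shows "eigenvalue (complex_mat (companion_mat p \<theta>)) z \<longleftrightarrow> poly (ar_poly p (\<lambda>j. \<theta> $ j)) z = 0"
proof -
  let ?A = "complex_mat (companion_mat p \<theta>)"
  have dim: "?A \<in> carrier_mat p p" by (simp add: companion_mat_def)
  have mult0: "(?A *\<^sub>v v) $ 0 = (\<Sum>j<p. of_real (\<theta> $ j) * v $ j)" if "v \<in> carrier_vec p" for v
    using that p by (simp add: companion_mat_def scalar_prod_def atLeast0LessThan)
  have multS: "(?A *\<^sub>v v) $ Suc i = v $ i" if "v \<in> carrier_vec p" "Suc i < p" for v i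
  proof -
    have "(?A *\<^sub>v v) $ Suc i = (\<Sum>j<p. of_real (if i = j then 1 else 0) * v $ j)"
      using that by (simp add: companion_mat_def scalar_prod_def atLeast0LessThan)
    also have "\<dots> = (\<Sum>j<p. if i = j then v $ j else 0)" by (rule sum.cong) auto
    also have "\<dots> = v $ i" using that by simp
    finally show ?thesis .
  qed
  show ?thesis
  proof
    assume "eigenvalue ?A z"
    then obtain v where v: "v \<in> carrier_vec p" "v \<noteq> 0\<^sub>v p" "?A *\<^sub>v v = z \<cdot>\<^sub>v v"
      using dim by (auto simp: eigenvalue_def eigenvector_def)
    have step: "v $ i = z * v $ Suc i" if "Suc i < p" for i
      using multS[OF v(1) that] v that by simp
    have pw: "v $ (p - 1 - k) = z ^ k * v $ (p - 1)" if "k \<le> p - 1" for k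
      using that
    proof (induction k)
      case (Suc k)
      then have e: "Suc (p - 1 - Suc k) = p - 1 - k" by auto
      show ?case using step[of "p - 1 - Suc k"] Suc unfolding e by (simp add: mult.assoc)
    qed simp
    have pw': "v $ j = z ^ (p - 1 - j) * v $ (p - 1)" if "j < p" for j
      using pw[of "p - 1 - j"] that by simp
    have nz: "v $ (p - 1) \<noteq> 0"
    proof
      assume "v $ (p - 1) = 0"
      then have "v = 0\<^sub>v p" using v(1) pw' by (intro eq_vecI) auto
      with v(2) show False by simp
    qed
    have "(\<Sum>j<p. of_real (\<theta> $ j) * (z ^ (p - 1 - j) * v $ (p - 1))) = z * (z ^ (p - 1) * v $ (p - 1))"
    proof -
      have "(\<Sum>j<p. of_real (\<theta> $ j) * (z ^ (p - 1 - j) * v $ (p - 1))) = (\<Sum>j<p. of_real (\<theta> $ j) * v $ j)"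
        by (rule sum.cong) (auto dest: pw')
      also have "\<dots> = z * v $ 0" using mult0[OF v(1)] v(1) p unfolding v(3) by simp
      also have "v $ 0 = z ^ (p - 1) * v $ (p - 1)" using pw'[of 0] p by simp
      finally show ?thesis .
    qed
    then have "(\<Sum>j<p. of_real (\<theta> $ j) * z ^ (p - 1 - j)) * v $ (p - 1) = z ^ p * v $ (p - 1)"
    proof -
      have "z ^ p = z * z ^ (p - 1)" using p by (cases p) auto
      then show ?thesis using \<open>_ = z * (z ^ (p - 1) * v $ (p - 1))\<close>
        by (simp add: sum_distrib_right mult.assoc)
    qed
    with nz show "poly (ar_poly p (\<lambda>j. \<theta> $ j)) z = 0" by (simp add: poly_ar_poly)
  next
    assume root: "poly (ar_poly p (\<lambda>j. \<theta> $ j)) z = 0"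
    define v where "v = vec p (\<lambda>j. z ^ (p - 1 - j))"
    have vc: "v \<in> carrier_vec p" by (simp add: v_def)
    have "v $ (p - 1) = 1" using p by (simp add: v_def)
    then have "v \<noteq> 0\<^sub>v p" using p by auto
    moreover have "?A *\<^sub>v v = z \<cdot>\<^sub>v v"
    proof (rule eq_vecI)
      fix i assume "i < dim_vec (z \<cdot>\<^sub>v v)"
      then have i: "i < p" by (simp add: v_def)
      show "(?A *\<^sub>v v) $ i = (z \<cdot>\<^sub>v v) $ i"
      proof (cases i)
        case 0
        have "(?A *\<^sub>v v) $ 0 = z ^ p"
          using root unfolding mult0[OF vc] by (simp add: poly_ar_poly v_def)
        then show ?thesis using 0 p by (cases p) (auto simp: v_def)
      next
        case (Suc k)
        then have "p - 1 - k = Suc (p - 1 - i)" using i by auto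
        then show ?thesis using Suc i multS[OF vc, of k] by (simp add: v_def)
      qed
    qed (simp add: companion_mat_def v_def)
    ultimately show "eigenvalue ?A z"
      using vc dim by (auto simp: eigenvalue_def eigenvector_def)
  qed
qed

text \<open>Distinct roots can be divided out one after the other. After \<open>p\<close> of them
  the quotient has degree zero, and it equals one because both sides are monic.\<close>

lemma ar_poly_eq_prod:
  assumes p: "p \<ge> 1" and inj: "inj_on lam {1..p}"
    and root: "\<And>i. i \<in> {1..p} \<Longrightarrow> poly (ar_poly p a) (lam i) = 0"
  shows "ar_poly p a = (\<Prod>i\<in>{1..p}. [:- lam i, 1:])"
proof -
  have *: "(\<Prod>i\<in>J. [:- lam i, 1:]) dvd ar_poly p a" if "J \<subseteq> {1..p}" for J
  proof -
    have "finite J" using that finite_subset by blast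
    then show ?thesis using that
    proof (induction J)
      case (insert i J)
      then obtain q where q: "ar_poly p a = (\<Prod>i\<in>J. [:- lam i, 1:]) * q" by auto
      \<comment> \<open>Distinctness enters here: the new root is not a root of the factors already
        removed, so its linear factor divides the remaining quotient.\<close>
      have "poly (\<Prod>i\<in>J. [:- lam i, 1:]) (lam i) \<noteq> 0"
      proof -
        have "lam i \<noteq> lam j" if "j \<in> J" for j
          using insert.hyps insert.prems that inj_onD[OF inj, of i j] by blast
        then show ?thesis using insert.hyps(1) by (simp add: poly_prod)
      qed
      moreover have "poly (ar_poly p a) (lam i) = 0" using insert root by auto
      ultimately have "[:- lam i, 1:] dvd q" by (simp add: q poly_eq_0_iff_dvd[symmetric])
      then have "[:- lam i, 1:] * (\<Prod>i\<in>J. [:- lam i, 1:]) dvd q * (\<Prod>i\<in>J. [:- lam i, 1:])"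
        by (rule mult_dvd_mono) simp
      then show ?case unfolding q using insert.hyps
        by (simp only: prod.insert mult.commute[of q] if_False not_False_eq_True)
    qed simp
  qed
  let ?P = "\<Prod>i\<in>{1..p}. [:- lam i, 1:]"
  obtain q where q: "ar_poly p a = ?P * q" using *[of "{1..p}"] by auto
  have degP: "degree ?P = p" by (subst degree_prod_eq_sum_degree) auto
  have "ar_poly p a \<noteq> 0" using coeff_ar_poly[of p a p] by auto
  then have "degree (ar_poly p a) = degree ?P + degree q"
    unfolding q by (intro degree_mult_eq) auto
  then have "degree q = 0" unfolding degree_ar_poly degP by simp
  then obtain b where b: "q = [:b:]" by (rule degree_eq_zeroE)
  have "lead_coeff ?P = 1" by (simp add: lead_coeff_prod)
  moreover have "lead_coeff (ar_poly p a) = lead_coeff ?P * lead_coeff q"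
    unfolding q by (rule lead_coeff_mult)
  ultimately have "b = 1" by (simp add: b degree_ar_poly coeff_ar_poly)
  then show ?thesis by (simp add: q b)
qed

section \<open>Dependence of the roots on the coefficients, and square sums of the inverse
  series\<close>

text \<open>The modulus of a monic polynomial at \<open>z\<close> is the product of the distances
  from \<open>z\<close> to its roots, so the smallest distance, raised to the degree, cannot exceed
  it. This gives continuity of roots without complex analysis.\<close>

lemma monic_root_near:
  fixes q :: "complex poly"
  assumes "lead_coeff q = 1" "degree q \<ge> 1"
  shows "\<exists>m. poly q m = 0 \<and> norm (z - m) ^ degree q \<le> norm (poly q z)"
proof (rule ccontr)
  assume neg: "\<not> ?thesis"
  obtain as where as: "(\<Prod>a\<leftarrow>as. [:- a, 1:]) = q" "length as = degree q"
    using fundamental_theorem_algebra_factorized[of q] assms by auto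
  have "poly q m = 0" if "m \<in> set as" for m
    using that unfolding as(1)[symmetric] by (induction as) auto
  then have far: "norm (z - m) ^ degree q > norm (poly q z)" if "m \<in> set as" for m
    using that neg by force
  \<comment> \<open>The geometric mean of the distances to the roots. If every distance exceeded it,
    their product would exceed \<open>norm (poly q z)\<close>.\<close>
  define d where "d = root (degree q) (norm (poly q z))"
  have dq: "d ^ degree q = norm (poly q z)" "d \<ge> 0" using assms by (auto simp: d_def)
  have gt: "norm (z - m) > d" if "m \<in> set as" for m
    using far[OF that] dq(1) power_less_imp_less_base[of d "degree q" "norm (z - m)"] by simp
  have val: "norm (poly q z) = (\<Prod>a\<leftarrow>as. norm (z - a))"
    unfolding as(1)[symmetric] by (induction as) (auto simp: norm_mult simp flip: left_diff_distrib)
  have "as \<noteq> []" using as assms by auto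
  then have "d ^ length as < (\<Prod>a\<leftarrow>as. norm (z - a))"
    using gt
  proof (induction as rule: list_nonempty_induct)
    case (cons x xs)
    then have "d * d ^ length xs < norm (z - x) * (\<Prod>a\<leftarrow>xs. norm (z - a))"
      using dq(2) by (intro mult_strict_mono') auto
    then show ?case by simp
  qed simp
  then show False using val as dq by simp
qed

lemma reflect_linear: "reflect_poly [:- m, 1::complex:] = [:1, - m:]"
proof -
  have "coeff (reflect_poly [:- m, 1:]) n = coeff [:1, - m:] n" for n
    by (cases n; cases "n - 1") (auto simp: coeff_reflect_poly)
  then show ?thesis by (simp add: poly_eq_iff)
qed

lemma fps_reflect_linear: "fps_of_poly (reflect_poly [:- m, 1::complex:]) = 1 - fps_const m * fps_X"
  by (simp add: reflect_linear fps_of_poly_pCons mult.commute flip: fps_const_neg)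

lemma geom_fps_nonvanishing_factor:
  "(\<Prod>i\<in>I. 1 - fps_const (m i) * fps_X) * (\<Prod>i\<in>I. geom_fps (m i)) = 1"
  by (simp add: geom_fps_inverse flip: prod.distrib)

text \<open>At a root \<open>z\<close> of the limit polynomial the values of the approximating
  polynomials tend to zero, and by \<open>monic_root_near\<close> so does the distance from
  \<open>z\<close> to a suitable root of each.\<close>

lemma root_seq_tendsto:
  assumes p: "p \<ge> 1" and a: "\<And>j. j < p \<Longrightarrow> (\<lambda>n. a n j) \<longlonglongrightarrow> \<alpha> j"
    and z: "poly (ar_poly p \<alpha>) z = 0"
  obtains m where "\<And>n. poly (ar_poly p (a n)) (m n) = 0" "m \<longlonglongrightarrow> z"
proof -
  have "\<exists>m. poly (ar_poly p (a n)) m = 0 \<and> norm (z - m) ^ p \<le> norm (poly (ar_poly p (a n)) z)" for n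
    using monic_root_near[of "ar_poly p (a n)" z] p by (simp add: degree_ar_poly coeff_ar_poly)
  then obtain m where m: "\<And>n. poly (ar_poly p (a n)) (m n) = 0"
    "\<And>n. norm (z - m n) ^ p \<le> norm (poly (ar_poly p (a n)) z)" by metis
  have "(\<lambda>n. poly (ar_poly p (a n)) z) \<longlonglongrightarrow> poly (ar_poly p \<alpha>) z"
    unfolding poly_ar_poly using a by (intro tendsto_intros) auto
  then have "(\<lambda>n. norm (poly (ar_poly p (a n)) z)) \<longlonglongrightarrow> 0"
    using z by (simp add: tendsto_norm_zero)
  then have "(\<lambda>n. norm (z - m n) ^ p) \<longlonglongrightarrow> 0"
    by (rule tendsto_sandwich[of "\<lambda>_. 0", rotated -1]) (auto intro!: always_eventually m(2))
  then have "(\<lambda>n. norm (z - m n)) \<longlonglongrightarrow> 0"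
    using p by (simp add: power_tendsto_0_iff)
  then have "(\<lambda>n. norm (m n - z)) \<longlonglongrightarrow> 0" by (simp only: norm_minus_commute)
  then have "m \<longlonglongrightarrow> z" by (simp add: tendsto_norm_zero_iff LIM_zero_iff)
  with m(1) show ?thesis by (rule that)
qed

text \<open>A root \<open>m n\<close> tending to \<open>lam 1\<close> is split off. The cofactor
  tends to the stable product \<open>q0\<close>, so its inverse is eventually bounded in l^1, and
  the whole factor \<open>1 / (1 - r n)\<close> comes from the geometric series of
  \<open>m n\<close>.\<close>

lemma ar_fps_inverse_square_sum:
  fixes a :: "nat \<Rightarrow> nat \<Rightarrow> real" and r :: "nat \<Rightarrow> real"
  assumes p: "p \<ge> 1" and a: "\<And>j. j < p \<Longrightarrow> (\<lambda>n. a n j) \<longlonglongrightarrow> \<alpha> j"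
    and fact: "ar_poly p \<alpha> = (\<Prod>i\<in>{1..p}. [:- lam i, 1:])"
    and small: "\<And>i. i \<in> {2..p} \<Longrightarrow> norm (lam i) < 1"
    and r: "\<And>n z. n \<ge> 1 \<Longrightarrow> poly (ar_poly p (a n)) z = 0 \<Longrightarrow> norm z \<le> r n"
    and r1: "eventually (\<lambda>n. r n < 1) sequentially"
  obtains C where "eventually (\<lambda>n. \<forall>N.
      (\<Sum>j<N. (norm (fps_nth (inverse (ar_fps p (a n))) j))\<^sup>2) \<le> C / (1 - r n)) sequentially"
proof -
  have split: "{1..p} = insert 1 {2..p}" using p by auto
  have "poly (ar_poly p \<alpha>) (lam 1) = 0" unfolding fact split by simp
  then obtain m where root: "\<And>n. poly (ar_poly p (a n)) (m n) = 0" and m: "m \<longlonglongrightarrow> lam 1"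
    using root_seq_tendsto[of p a \<alpha> "lam 1"] p a by auto
  have "\<exists>k. ar_poly p (a n) = [:- m n, 1:] * k" for n
    using root[of n] unfolding poly_eq_0_iff_dvd by (rule dvdE) blast
  then obtain k where k: "\<And>n. ar_poly p (a n) = [:- m n, 1:] * k n" by metis
  define q where "q n = fps_of_poly (reflect_poly (k n))" for n
  define q0 where "q0 = (\<Prod>i\<in>{2..p}. 1 - fps_const (lam i) * fps_X)"
  define g where "g = (\<Prod>i\<in>{2..p}. geom_fps (lam i))"
  have qg: "q0 * g = 1" by (simp add: q0_def g_def geom_fps_nonvanishing_factor)
  obtain G where G: "\<And>N. fps_l1 N g \<le> G"
    using fps_prod_geom_l1[of "{2..p}" lam] small unfolding g_def by auto
  have Pn: "ar_fps p (a n) = (1 - fps_const (m n) * fps_X) * q n" for n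
    by (simp only: fps_reflect_ar_poly[symmetric] k reflect_poly_mult fps_of_poly_mult
        fps_reflect_linear q_def)
  have P0: "ar_fps p \<alpha> = (1 - fps_const (lam 1) * fps_X) * q0"
    by (simp only: fps_reflect_ar_poly[symmetric] fact reflect_poly_prod fps_of_poly_prod
        fps_reflect_linear q0_def split) simp
  have "degree (k n) < p" "k n \<noteq> 0" for n
  proof -
    show "k n \<noteq> 0" using k[of n] degree_ar_poly[of p "a n"] p by auto
    then have "degree (ar_poly p (a n)) = 1 + degree (k n)"
      unfolding k by (subst degree_mult_eq) auto
    then show "degree (k n) < p" by (simp add: degree_ar_poly)
  qed
  note kd = this
  \<comment> \<open>Both cofactors are polynomials of degree below \<open>p\<close>, so a bound on
    the coefficients up to \<open>p\<close> controls \<open>fps_l1 N\<close> for all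
    \<open>N\<close> at once.\<close>
  have q_high: "fps_nth (q n) j = 0" if "j > p" for n j
    using kd[of n] that by (simp add: q_def coeff_reflect_poly)
  have q0_poly: "q0 = fps_of_poly (reflect_poly (\<Prod>i\<in>{2..p}. [:- lam i, 1:]))"
    by (simp only: q0_def reflect_poly_prod fps_of_poly_prod fps_reflect_linear)
  have "degree (\<Prod>i\<in>{2..p}. [:- lam i, 1:]) = p - 1"
    by (subst degree_prod_eq_sum_degree) auto
  then have q0_high: "fps_nth q0 j = 0" if "j > p" for j
    using that by (simp add: q0_poly coeff_reflect_poly)
  \<comment> \<open>This is \<open>(1 - m n z) * (q n - q0)\<close> expressed through quantities
    known to converge: the coefficients and the root. Its coefficients tend to zero, and the
    geometric series of \<open>m n\<close> recovers \<open>q n - q0\<close> from it.\<close>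
  define D where "D n = ar_fps p (a n) - ar_fps p \<alpha> + fps_const (m n - lam 1) * fps_X * q0" for n
  have D: "q n - q0 = geom_fps (m n) * D n" for n
  proof -
    have "(1 - fps_const (m n) * fps_X) * (q n - q0) = D n"
      by (simp add: D_def Pn P0 algebra_simps flip: fps_const_sub)
    then have "geom_fps (m n) * ((1 - fps_const (m n) * fps_X) * (q n - q0)) = geom_fps (m n) * D n"
      by simp
    moreover have "geom_fps (m n) * ((1 - fps_const (m n) * fps_X) * (q n - q0))
        = ((1 - fps_const (m n) * fps_X) * geom_fps (m n)) * (q n - q0)"
      by (simp only: mult_ac)
    ultimately show ?thesis by (simp only: geom_fps_inverse mult_1)
  qed
  have "(\<lambda>n. fps_l1 p (D n)) \<longlonglongrightarrow> (\<Sum>j\<le>p. norm (0::complex))"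
    unfolding fps_l1_def
  proof (intro tendsto_sum tendsto_norm)
    fix j assume j: "j \<in> {..p}"
    have 1: "(\<lambda>n. fps_nth (ar_fps p (a n)) j) \<longlonglongrightarrow> fps_nth (ar_fps p \<alpha>) j"
      using j unfolding ar_fps_def
      by (cases "j = 0") (auto intro!: tendsto_intros a)
    have 2: "(\<lambda>n. (m n - lam 1) * fps_nth (fps_X * q0) j) \<longlonglongrightarrow> (lam 1 - lam 1) * fps_nth (fps_X * q0) j"
      by (intro tendsto_intros m)
    have "(\<lambda>n. fps_nth (ar_fps p (a n)) j - fps_nth (ar_fps p \<alpha>) j + (m n - lam 1) * fps_nth (fps_X * q0) j)
        \<longlonglongrightarrow> fps_nth (ar_fps p \<alpha>) j - fps_nth (ar_fps p \<alpha>) j + (lam 1 - lam 1) * fps_nth (fps_X * q0) j"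
      by (intro tendsto_add tendsto_diff 1 2 tendsto_const)
    then show "(\<lambda>n. fps_nth (D n) j) \<longlonglongrightarrow> 0"
      by (simp add: D_def mult.assoc)
  qed
  then have D0: "(\<lambda>n. real (p + 1) * fps_l1 p (D n) * G) \<longlonglongrightarrow> real (p + 1) * 0 * G"
    by (intro tendsto_intros) simp
  have ev: "eventually (\<lambda>n. real (p + 1) * fps_l1 p (D n) * G < 1 / 2) sequentially"
    using order_tendstoD(2)[OF D0, of "1/2"] by simp
  have "eventually (\<lambda>n. \<forall>N.
      (\<Sum>j<N. (norm (fps_nth (inverse (ar_fps p (a n))) j))\<^sup>2) \<le> (2 * G)\<^sup>2 / (1 - r n)) sequentially"
    using ev r1 eventually_ge_at_top[of 1]
  proof eventually_elim
    case (elim n)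
    have G0: "0 \<le> G" using G fps_l1_nonneg order_trans by blast
    have mr: "norm (m n) \<le> r n" using r[OF _ root] elim by simp
    then have m1: "norm (m n) < 1" using elim by simp
    have q1: "fps_nth (q n) 0 = 1"
    proof -
      have "fps_nth (ar_fps p (a n)) 0 = 1" by (simp add: ar_fps_def)
      then show ?thesis by (simp add: Pn)
    qed
    then have inv: "q n * inverse (q n) = 1" by (simp add: inverse_mult_eq_1')
    \<comment> \<open>Counting the \<open>p + 1\<close> coefficients, each of modulus at most one,
      gives a bound free of \<open>1 / (1 - norm (m n))\<close>, which could grow with
      \<open>n\<close>.\<close>
    have gp: "fps_l1 p (geom_fps (m n)) \<le> real (p + 1)"
    proof -
      have "fps_l1 p (geom_fps (m n)) \<le> (\<Sum>j\<le>p. 1)"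
        unfolding fps_l1_def geom_fps_def using m1
        by (intro sum_mono) (simp add: norm_power power_le_one)
      then show ?thesis by simp
    qed
    have bound: "fps_l1 N (q n - q0) * G \<le> 1 / 2" for N
    proof -
      have "fps_l1 N (q n - q0) \<le> fps_l1 (max N p) (q n - q0)"
        unfolding fps_l1_def by (rule sum_mono2) auto
      also have "\<dots> = fps_l1 p (q n - q0)"
        unfolding fps_l1_def by (rule sum.mono_neutral_right) (auto simp: q_high q0_high)
      also have "\<dots> \<le> fps_l1 p (geom_fps (m n)) * fps_l1 p (D n)"
        unfolding D by (rule fps_l1_mult)
      also have "\<dots> \<le> real (p + 1) * fps_l1 p (D n)"
        by (intro mult_right_mono gp fps_l1_nonneg)
      finally have "fps_l1 N (q n - q0) * G \<le> real (p + 1) * fps_l1 p (D n) * G"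
        by (rule mult_right_mono) (rule G0)
      with elim show ?thesis by simp
    qed
    have "fps_l1 N (inverse (q n)) \<le> 2 * G" for N
      by (rule fps_l1_inverse_perturb[OF qg inv G bound])
    note S = geom_mult_square_sum[OF this m1]
    have "inverse (ar_fps p (a n)) = geom_fps (m n) * inverse (q n)"
    proof -
      have "ar_fps p (a n) * (geom_fps (m n) * inverse (q n))
          = ((1 - fps_const (m n) * fps_X) * geom_fps (m n)) * (q n * inverse (q n))"
        by (simp only: Pn mult_ac)
      then have "ar_fps p (a n) * (geom_fps (m n) * inverse (q n)) = 1"
        by (simp only: geom_fps_inverse inv mult_1)
      then show ?thesis by (metis fps_inverse_unique mult.commute)
    qed
    then have "(\<Sum>j<N. (norm (fps_nth (inverse (ar_fps p (a n))) j))\<^sup>2) \<le> (2 * G)\<^sup>2 / (1 - norm (m n))" for N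
      using S[of N] by simp
    moreover have "(2 * G)\<^sup>2 / (1 - norm (m n)) \<le> (2 * G)\<^sup>2 / (1 - r n)"
      using mr elim by (intro divide_left_mono mult_pos_pos) auto
    ultimately show ?case by (meson order_trans)
  qed
  then show ?thesis by (rule that)
qed

section \<open>Solutions of the autoregressive recursion\<close>

text \<open>Gram-Schmidt for sequences restricted to \<open>K\<close>. A vector whose residual
  vanishes contributes no new basis element, so \<open>d\<close> may be smaller than
  \<open>card I\<close>.\<close>

lemma finite_orthonormal_span:
  fixes u :: "'i \<Rightarrow> 'k \<Rightarrow> real"
  assumes I: "finite I" and K: "finite K"
  shows "\<exists>d f. d \<le> card I \<and>
    (\<forall>l<d. \<forall>m<d. (\<Sum>k\<in>K. f l k * f m k) = (if l = m then 1 else 0)) \<and>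
    (\<forall>i\<in>I. \<exists>c. \<forall>k\<in>K. u i k = (\<Sum>l<d. c l * f l k))"
  using I
proof (induction I)
  case empty
  show ?case by (rule exI[of _ 0]) auto
next
  case (insert a I)
  then obtain d :: nat and f where d: "d \<le> card I"
    and on': "\<forall>l<d. \<forall>m<d. (\<Sum>k\<in>K. f l k * f m k) = (if l = m then 1 else 0)"
    and span': "\<forall>i\<in>I. \<exists>c. \<forall>k\<in>K. u i k = (\<Sum>l<d. c l * f l k)" by blast
  have on: "(\<Sum>k\<in>K. f l k * f m k) = (if l = m then 1 else 0)" if "l < d" "m < d" for l m
    using on' that by blast
  have span: "\<exists>c. \<forall>k\<in>K. u i k = (\<Sum>l<d. c l * f l k)" if "i \<in> I" for i
    using span' that by blast
  define b where "b l = (\<Sum>k\<in>K. u a k * f l k)" for l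
  define r where "r k = u a k - (\<Sum>l<d. b l * f l k)" for k
  have r_orth: "(\<Sum>k\<in>K. r k * f m k) = 0" if m: "m < d" for m
  proof -
    have "(\<Sum>k\<in>K. (\<Sum>l<d. b l * f l k) * f m k) = (\<Sum>l<d. b l * (\<Sum>k\<in>K. f l k * f m k))"
      unfolding sum_distrib_left sum_distrib_right by (subst sum.swap) (simp add: mult_ac)
    also have "\<dots> = (\<Sum>l<d. if l = m then b l else 0)" by (rule sum.cong) (auto simp: on m)
    also have "\<dots> = b m" using m by simp
    finally show ?thesis by (simp add: r_def left_diff_distrib sum_subtractf b_def)
  qed
  show ?case
  proof (cases "(\<Sum>k\<in>K. (r k)\<^sup>2) = 0")
    case True
    then have "\<forall>k\<in>K. r k = 0" using K by (simp add: sum_nonneg_eq_0_iff)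
    then have "\<forall>k\<in>K. u a k = (\<Sum>l<d. b l * f l k)" by (simp add: r_def)
    then show ?thesis using d on span insert.hyps
      by (intro exI[of _ d] exI[of _ f]) (auto simp: card_insert_disjoint)
  next
    case False
    define t where "t = sqrt (\<Sum>k\<in>K. (r k)\<^sup>2)"
    have t: "t > 0" using False by (simp add: t_def sum_nonneg order_less_le)
    have t2: "(\<Sum>k\<in>K. (r k)\<^sup>2) = t * t" by (simp add: t_def sum_nonneg)
    define g where "g = f(d := (\<lambda>k. r k / t))"
    have glow: "g l = f l" if "l < d" for l using that by (simp add: g_def)
    have gd: "g d k = r k / t" for k by (simp add: g_def)
    have gr: "(\<Sum>k\<in>K. g d k * f m k) = 0" if "m < d" for m
      using r_orth[OF that] by (simp add: gd flip: sum_divide_distrib)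
    have gg: "(\<Sum>k\<in>K. g d k * g d k) = 1"
      using t t2 by (simp add: gd power2_eq_square flip: sum_divide_distrib)
    have "(\<Sum>k\<in>K. g l k * g m k) = (if l = m then 1 else 0)" if "l < Suc d" "m < Suc d" for l m
      using that on[of l m] gr[of l] gr[of m] gg
      by (auto simp: less_Suc_eq glow mult.commute)
    moreover have "\<exists>c. \<forall>k\<in>K. u i k = (\<Sum>l<Suc d. c l * g l k)" if i: "i \<in> insert a I" for i
    proof (cases "i = a")
      case True
      have "u a k = (\<Sum>l<Suc d. (b(d := t)) l * g l k)" for k
        using t by (simp add: gd glow r_def)
      then show ?thesis using True by blast
    next
      case False
      then obtain c where "\<forall>k\<in>K. u i k = (\<Sum>l<d. c l * f l k)" using span[of i] i False by blast
      then have "\<forall>k\<in>K. u i k = (\<Sum>l<Suc d. (c(d := 0)) l * g l k)" by (simp add: glow)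
      then show ?thesis by blast
    qed
    ultimately show ?thesis using d insert.hyps
      by (intro exI[of _ "Suc d"] exI[of _ g]) (auto simp: card_insert_disjoint)
  qed
qed

text \<open>
  The first factor on the right is the squared norm of the orthogonal projection of \<open>e\<close> onto the
  span: for white noise its expectation depends on nothing but the dimension.
\<close>

lemma span_projection_bound:
  fixes u :: "'i \<Rightarrow> 'k \<Rightarrow> real"
  assumes I: "finite I" and K: "finite K"
  obtains d :: nat and f where "d \<le> card I" "\<And>l. l < d \<Longrightarrow> (\<Sum>k\<in>K. (f l k)\<^sup>2) = 1"
    "\<And>c e. (\<Sum>k\<in>K. e k * (\<Sum>i\<in>I. c i * u i k))\<^sup>2
        \<le> (\<Sum>l<d. (\<Sum>k\<in>K. f l k * e k)\<^sup>2) * (\<Sum>k\<in>K. (\<Sum>i\<in>I. c i * u i k)\<^sup>2)"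
proof -
  obtain d :: nat and f where d: "d \<le> card I"
    and on': "\<forall>l<d. \<forall>m<d. (\<Sum>k\<in>K. f l k * f m k) = (if l = m then 1 else 0)"
    and span: "\<forall>i\<in>I. \<exists>c. \<forall>k\<in>K. u i k = (\<Sum>l<d. c l * f l k)"
    using finite_orthonormal_span[OF I K, of u] by blast
  have on: "(\<Sum>k\<in>K. f l k * f m k) = (if l = m then 1 else 0)" if "l < d" "m < d" for l m
    using on' that by blast
  from bchoice[OF span] obtain C where
    "\<forall>i\<in>I. \<forall>k\<in>K. u i k = (\<Sum>l<d. C i l * f l k)" by blast
  then have C: "u i k = (\<Sum>l<d. C i l * f l k)" if "i \<in> I" "k \<in> K" for i k
    using that by blast
  have norm1: "(\<Sum>k\<in>K. (f l k)\<^sup>2) = 1" if "l < d" for l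
    using on[OF that that] by (simp add: power2_eq_square)
  have "(\<Sum>k\<in>K. e k * (\<Sum>i\<in>I. c i * u i k))\<^sup>2
        \<le> (\<Sum>l<d. (\<Sum>k\<in>K. f l k * e k)\<^sup>2) * (\<Sum>k\<in>K. (\<Sum>i\<in>I. c i * u i k)\<^sup>2)" for c e
  proof -
    \<comment> \<open>The coordinates of the combination in the orthonormal basis. The left side is
      then the square of a scalar product of coordinate vectors and the second factor on the right
      is the sum of the \<open>(b l)\<^sup>2\<close>, so Cauchy-Schwarz applies.\<close>
    define b where "b l = (\<Sum>i\<in>I. c i * C i l)" for l
    have ell: "(\<Sum>i\<in>I. c i * u i k) = (\<Sum>l<d. b l * f l k)" if "k \<in> K" for k
    proof -
      have "(\<Sum>i\<in>I. c i * u i k) = (\<Sum>i\<in>I. \<Sum>l<d. c i * C i l * f l k)"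
        using that by (simp add: C sum_distrib_left mult.assoc)
      also have "\<dots> = (\<Sum>l<d. b l * f l k)"
        unfolding b_def sum_distrib_right by (rule sum.swap)
      finally show ?thesis .
    qed
    have "(\<Sum>k\<in>K. e k * (\<Sum>i\<in>I. c i * u i k)) = (\<Sum>k\<in>K. \<Sum>l<d. b l * (f l k * e k))"
      by (simp add: ell sum_distrib_left mult_ac)
    also have "\<dots> = (\<Sum>l<d. b l * (\<Sum>k\<in>K. f l k * e k))"
      unfolding sum_distrib_left by (rule sum.swap)
    finally have 1: "(\<Sum>k\<in>K. e k * (\<Sum>i\<in>I. c i * u i k)) = (\<Sum>l<d. b l * (\<Sum>k\<in>K. f l k * e k))" .
    have "(\<Sum>k\<in>K. (\<Sum>i\<in>I. c i * u i k)\<^sup>2) = (\<Sum>k\<in>K. \<Sum>l<d. \<Sum>m<d. b l * b m * (f l k * f m k))"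
      by (simp add: ell power2_eq_square sum_product mult_ac)
    also have "\<dots> = (\<Sum>l<d. \<Sum>m<d. b l * b m * (\<Sum>k\<in>K. f l k * f m k))"
      unfolding sum_distrib_left by (subst sum.swap, rule sum.cong[OF refl], rule sum.swap)
    also have "\<dots> = (\<Sum>l<d. \<Sum>m<d. if l = m then (b l)\<^sup>2 else 0)"
      by (intro sum.cong refl) (auto simp: on power2_eq_square)
    also have "\<dots> = (\<Sum>l<d. (b l)\<^sup>2)" by simp
    finally have 2: "(\<Sum>k\<in>K. (\<Sum>i\<in>I. c i * u i k)\<^sup>2) = (\<Sum>l<d. (b l)\<^sup>2)" .
    show ?thesis unfolding 1 2
      using Cauchy_Schwarz_ineq_sum[of b "\<lambda>l. \<Sum>k\<in>K. f l k * e k" "{..<d}"]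
      by (simp add: mult.commute)
  qed
  with d norm1 show ?thesis by (rule that)
qed

section \<open>Homogeneous solutions and the impulse response\<close>

text \<open>For indices below \<open>p\<close> these are the entries of the \<open>k\<close>-th
  power of the companion matrix, computed by multiplying from the left.\<close>

primrec ar_propagator :: "nat \<Rightarrow> (nat \<Rightarrow> real) \<Rightarrow> nat \<Rightarrow> nat \<Rightarrow> nat \<Rightarrow> real" where
  "ar_propagator p a 0 = (\<lambda>i r. if i = r then 1 else 0)"
| "ar_propagator p a (Suc k) = (\<lambda>i r. if i = 0 then \<Sum>j<p. a j * ar_propagator p a k j r
      else ar_propagator p a k (i - 1) r)"

text \<open>A homogeneous solution depends on its initial values only through the coefficients of a
  linear combination of sequences fixed by \<open>a\<close>. This is what makes arbitrary initial
  vectors harmless.\<close>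

lemma ar_propagator_eq:
  assumes rec: "\<And>k. 1 \<le> k \<Longrightarrow> k \<le> n \<Longrightarrow> d (int k) = (\<Sum>j<p. a j * d (int k - 1 - int j))"
    and "k \<le> n" "i < p"
  shows "d (int k - int i) = (\<Sum>r<p. ar_propagator p a k i r * d (- int r))"
  using assms(2,3)
proof (induction k arbitrary: i)
  case 0
  have "(\<Sum>r<p. ar_propagator p a 0 i r * d (- int r)) = (\<Sum>r<p. if i = r then d (- int r) else 0)"
    by (rule sum.cong) auto
  then show ?case using 0 by simp
next
  case (Suc k)
  show ?case
  proof (cases i)
    case 0
    have "d (int (Suc k)) = (\<Sum>j<p. a j * d (int k - int j))"
      using rec[of "Suc k"] Suc.prems by (simp add: algebra_simps)
    also have "\<dots> = (\<Sum>j<p. \<Sum>r<p. a j * ar_propagator p a k j r * d (- int r))"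
      using Suc by (intro sum.cong refl) (simp add: sum_distrib_left mult.assoc)
    also have "\<dots> = (\<Sum>r<p. ar_propagator p a (Suc k) 0 r * d (- int r))"
      by (subst sum.swap) (simp add: sum_distrib_right)
    finally show ?thesis using 0 by simp
  next
    case (Suc l)
    then show ?thesis using Suc.IH[of l] Suc.prems by simp
  qed
qed

text \<open>Extending the inverse series by zero to negative integers lets time shifts be written
  without case distinctions. Real coefficients are used here because the process is real.\<close>

definition impulse :: "nat \<Rightarrow> (nat \<Rightarrow> real) \<Rightarrow> int \<Rightarrow> real" where
  "impulse p a k = (if k < 0 then 0 else
     fps_nth (inverse (Abs_fps (\<lambda>i. if i = 0 then 1 else if i \<le> p then - a (i - 1) else 0))) (nat k))"

lemma impulse_neg: "k < 0 \<Longrightarrow> impulse p a k = 0"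
  by (simp add: impulse_def)

lemma impulse_nonzero: "impulse p a k \<noteq> 0 \<Longrightarrow> 0 \<le> k"
  using impulse_neg[of k] by (cases "k < 0") auto

text \<open>The real inverse, embedded in the complex series, also inverts \<open>ar_fps\<close>,
  and inverses are unique. This carries the complex root analysis over to the real impulse
  response.\<close>

lemma impulse_complex: "fps_nth (inverse (ar_fps p a)) j = of_real (impulse p a (int j))"
proof -
  define P :: "real fps" where "P = Abs_fps (\<lambda>i. if i = 0 then 1 else if i \<le> p then - a (i - 1) else 0)"
  define H where "H = Abs_fps (\<lambda>j. complex_of_real (fps_nth (inverse P) j))"
  have P: "P * inverse P = 1" by (rule inverse_mult_eq_1') (simp add: P_def)
  have "ar_fps p a * H = 1"
  proof (rule fps_ext)
    fix k
    have "fps_nth (ar_fps p a * H) k = of_real (fps_nth (P * inverse P) k)"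
      unfolding fps_mult_nth of_real_sum
      by (rule sum.cong) (auto simp: ar_fps_def H_def P_def)
    then show "fps_nth (ar_fps p a * H) k = fps_nth 1 k" by (simp add: P)
  qed
  then have "inverse (ar_fps p a) = H" by (metis fps_inverse_unique mult.commute)
  then show ?thesis by (simp add: H_def impulse_def P_def)
qed

text \<open>Comparison of coefficients in \<open>P * inverse P = 1\<close>. Thanks to the extension
  by zero the recursion holds at every integer, with a unit input at time zero.\<close>

lemma impulse_rec: "impulse p a k = (\<Sum>j<p. a j * impulse p a (k - 1 - int j)) + (if k = 0 then 1 else 0)"
proof (cases "k \<le> 0")
  case True
  then have "(\<Sum>j<p. a j * impulse p a (k - 1 - int j)) = 0"
    by (intro sum.neutral) (auto simp: impulse_neg)
  moreover have "impulse p a 0 = 1" by (simp add: impulse_def)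
  ultimately show ?thesis using True by (auto simp: impulse_neg)
next
  case False
  then obtain m where m: "k = int (Suc m)" by (metis gr0_implies_Suc linorder_not_le nat_0_iff nat_int zero_less_imp_eq_int)
  define P where "P = Abs_fps (\<lambda>i. if i = 0 then 1 else if i \<le> p then - a (i - 1) else 0)"
  have imp: "impulse p a (int j) = fps_nth (inverse P) j" for j by (simp add: impulse_def P_def)
  have "P * inverse P = 1" by (rule inverse_mult_eq_1') (simp add: P_def)
  then have "0 = fps_nth (P * inverse P) (Suc m)" by simp
  also have "\<dots> = (\<Sum>i=0..Suc m. fps_nth P i * impulse p a (int (Suc m - i)))"
    unfolding fps_mult_nth by (intro sum.cong refl) (simp only: imp)
  also have "\<dots> = impulse p a k + (\<Sum>i=0..m. fps_nth P (Suc i) * impulse p a (int (m - i)))"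
    by (subst sum.atLeast0_atMost_Suc_shift) (simp add: P_def m)
  also have "(\<Sum>i=0..m. fps_nth P (Suc i) * impulse p a (int (m - i)))
      = (\<Sum>i\<in>{0..m} \<inter> {..<p}. fps_nth P (Suc i) * impulse p a (int (m - i)))"
    by (rule sum.mono_neutral_right) (auto simp: P_def)
  also have "\<dots> = (\<Sum>i\<in>{0..m} \<inter> {..<p}. - (a i * impulse p a (k - 1 - int i)))"
    by (rule sum.cong) (auto simp: P_def m of_nat_diff)
  also have "\<dots> = (\<Sum>i<p. - (a i * impulse p a (k - 1 - int i)))"
  proof (rule sum.mono_neutral_left)
    show "\<forall>i\<in>{..<p} - {0..m} \<inter> {..<p}. - (a i * impulse p a (k - 1 - int i)) = 0"
    proof
      fix i assume "i \<in> {..<p} - {0..m} \<inter> {..<p}"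
      then have "m < i" by auto
      then show "- (a i * impulse p a (k - 1 - int i)) = 0" by (simp add: m impulse_neg)
    qed
  qed auto
  finally show ?thesis using False by (simp add: sum_negf)
qed

text \<open>The lags \<open>z - l\<close> that are not negative are distinct and smaller than
  \<open>n\<close>, so the bound does not depend on \<open>z\<close>.\<close>

lemma impulse_shift_sum:
  assumes "z < int n"
  shows "(\<Sum>l=1..n. (impulse p a (z - int l))\<^sup>2) \<le> (\<Sum>j<n. (impulse p a (int j))\<^sup>2)"
proof -
  define L where "L = {l\<in>{1..n}. int l \<le> z}"
  have "(\<Sum>l=1..n. (impulse p a (z - int l))\<^sup>2) = (\<Sum>l\<in>L. (impulse p a (int (nat (z - int l))))\<^sup>2)"
  proof -
    have "(\<Sum>l=1..n. (impulse p a (z - int l))\<^sup>2) = (\<Sum>l\<in>L. (impulse p a (z - int l))\<^sup>2)"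
      by (rule sum.mono_neutral_right) (auto simp: L_def dest: impulse_nonzero)
    also have "\<dots> = (\<Sum>l\<in>L. (impulse p a (int (nat (z - int l))))\<^sup>2)"
      by (rule sum.cong) (auto simp: L_def)
    finally show ?thesis .
  qed
  also have "\<dots> = (\<Sum>j\<in>(\<lambda>l. nat (z - int l)) ` L. (impulse p a (int j))\<^sup>2)"
    by (subst sum.reindex) (auto simp: inj_on_def L_def)
  also have "\<dots> \<le> (\<Sum>j<n. (impulse p a (int j))\<^sup>2)"
    using assms by (intro sum_mono2) (auto simp: L_def)
  finally show ?thesis .
qed

text \<open>The response to the noise from zero initial values. The sum may run over all of
  \<open>1..n\<close> because noise later than \<open>k\<close> has weight zero; for the same reason
  the values at \<open>k \<le> 0\<close> vanish.\<close>

definition driven :: "nat \<Rightarrow> (nat \<Rightarrow> real) \<Rightarrow> nat \<Rightarrow> (nat \<Rightarrow> real) \<Rightarrow> int \<Rightarrow> real" where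
  "driven p a n e k = (\<Sum>l=1..n. impulse p a (k - int l) * e l)"

lemma driven_rec:
  assumes "1 \<le> k" "k \<le> n"
  shows "driven p a n e (int k) = (\<Sum>j<p. a j * driven p a n e (int k - 1 - int j)) + e k"
proof -
  have "driven p a n e (int k) = (\<Sum>l=1..n. (\<Sum>j<p. a j * impulse p a (int k - 1 - int j - int l)) * e l
      + (if l = k then e l else 0))"
    unfolding driven_def by (intro sum.cong refl) (subst impulse_rec, simp add: algebra_simps)
  also have "\<dots> = (\<Sum>l=1..n. \<Sum>j<p. a j * (impulse p a (int k - 1 - int j - int l) * e l)) + e k"
  proof -
    have "(\<Sum>l=1..n. if l = k then e l else 0) = e k" using assms by simp
    then show ?thesis by (simp only: sum.distrib sum_distrib_right mult.assoc)
  qed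
  also have "(\<Sum>l=1..n. \<Sum>j<p. a j * (impulse p a (int k - 1 - int j - int l) * e l))
      = (\<Sum>j<p. a j * driven p a n e (int k - 1 - int j))"
    unfolding driven_def sum_distrib_left by (rule sum.swap)
  finally show ?thesis .
qed

section \<open>Deterministic bounds for the least squares error\<close>

lemma sum_shift_square_le:
  fixes f :: "nat \<Rightarrow> real"
  assumes "j < p"
  shows "(\<Sum>k=p..<n. (f (k - Suc j))\<^sup>2) \<le> (\<Sum>k<n. (f k)\<^sup>2)"
proof -
  have inj: "inj_on (\<lambda>k. k - Suc j) {p..<n}" using assms by (auto simp: inj_on_def)
  have "(\<Sum>k=p..<n. (f (k - Suc j))\<^sup>2) = (\<Sum>k\<in>(\<lambda>k. k - Suc j) ` {p..<n}. (f k)\<^sup>2)"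
    by (simp add: sum.reindex[OF inj])
  also have "\<dots> \<le> (\<Sum>k<n. (f k)\<^sup>2)" using assms by (intro sum_mono2) auto
  finally show ?thesis .
qed

text \<open>The autoregressive filter commutes with the fixed combination \<open>b\<close>, so it
  turns the combined process into the moving average of the noise. Cauchy-Schwarz over the lags and
  the energy bound for shifts give the constant.\<close>

lemma ar_filter_bound:
  fixes x :: "int \<Rightarrow> real"
  assumes rec: "\<And>k. 1 \<le> k \<Longrightarrow> k \<le> n \<Longrightarrow> x (int k) = (\<Sum>j<p. a j * x (int k - 1 - int j)) + e k"
  shows "(\<Sum>k=p..<n. (\<Sum>i<p. b i * e (k - i))\<^sup>2)
    \<le> 2 * (1 + (\<Sum>j<p. (a j)\<^sup>2)) * (1 + real p) * (\<Sum>k<n. (\<Sum>i<p. b i * x (int k - int i))\<^sup>2)"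
proof -
  define y where "y k = (\<Sum>i<p. b i * x (int k - int i))" for k
  define S where "S = (\<Sum>j<p. (a j)\<^sup>2)"
  have S0: "0 \<le> S" by (simp add: S_def sum_nonneg)
  \<comment> \<open>From time \<open>p\<close> on, all times \<open>k - i\<close> with
    \<open>i < p\<close> are at least one: the recursion applies at each of them and no natural
    subtraction is truncated.\<close>
  have pt: "(\<Sum>i<p. b i * e (k - i))\<^sup>2 \<le> 2 * (1 + S) * ((y k)\<^sup>2 + (\<Sum>j<p. (y (k - 1 - j))\<^sup>2))"
    if k: "k \<in> {p..<n}" for k
  proof -
    have e: "e (k - i) = x (int k - int i) - (\<Sum>j<p. a j * x (int (k - 1 - j) - int i))" if i: "i < p" for i
    proof -
      have "x (int (k - i)) = (\<Sum>j<p. a j * x (int (k - i) - 1 - int j)) + e (k - i)"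
        using i k by (intro rec) auto
      moreover have "(\<Sum>j<p. a j * x (int (k - i) - 1 - int j)) = (\<Sum>j<p. a j * x (int (k - 1 - j) - int i))"
      proof (intro sum.cong refl)
        fix j assume "j \<in> {..<p}"
        then have "int (k - i) - 1 - int j = int (k - 1 - j) - int i" using i k by auto
        then show "a j * x (int (k - i) - 1 - int j) = a j * x (int (k - 1 - j) - int i)" by simp
      qed
      moreover have "int (k - i) = int k - int i" using i k by auto
      ultimately show ?thesis by simp
    qed
    have "(\<Sum>i<p. b i * e (k - i)) = y k - (\<Sum>i<p. \<Sum>j<p. a j * (b i * x (int (k - 1 - j) - int i)))"
      by (simp add: y_def e right_diff_distrib sum_subtractf sum_distrib_left mult_ac)
    also have "(\<Sum>i<p. \<Sum>j<p. a j * (b i * x (int (k - 1 - j) - int i))) = (\<Sum>j<p. a j * y (k - 1 - j))"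
      unfolding y_def sum_distrib_left by (rule sum.swap)
    finally have "(\<Sum>i<p. b i * e (k - i)) = y k - (\<Sum>j<p. a j * y (k - 1 - j))" .
    moreover have "(y k - t)\<^sup>2 \<le> 2 * (y k)\<^sup>2 + 2 * t\<^sup>2" for t
      using zero_le_power2[of "y k + t"] by (simp add: power2_eq_square algebra_simps)
    moreover have "(\<Sum>j<p. a j * y (k - 1 - j))\<^sup>2 \<le> S * (\<Sum>j<p. (y (k - 1 - j))\<^sup>2)"
      unfolding S_def by (rule Cauchy_Schwarz_ineq_sum)
    ultimately have "(\<Sum>i<p. b i * e (k - i))\<^sup>2 \<le> 2 * (y k)\<^sup>2 + 2 * (S * (\<Sum>j<p. (y (k - 1 - j))\<^sup>2))"
      by (smt (verit))
    also have "\<dots> \<le> 2 * (1 + S) * ((y k)\<^sup>2 + (\<Sum>j<p. (y (k - 1 - j))\<^sup>2))"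
      using S0 by (simp add: algebra_simps sum_nonneg)
    finally show ?thesis .
  qed
  have "(\<Sum>k=p..<n. (\<Sum>i<p. b i * e (k - i))\<^sup>2)
      \<le> (\<Sum>k=p..<n. 2 * (1 + S) * ((y k)\<^sup>2 + (\<Sum>j<p. (y (k - 1 - j))\<^sup>2)))"
    by (rule sum_mono) (rule pt)
  also have "\<dots> = 2 * (1 + S) * ((\<Sum>k=p..<n. (y k)\<^sup>2) + (\<Sum>j<p. \<Sum>k=p..<n. (y (k - 1 - j))\<^sup>2))"
    by (subst sum.swap) (simp add: sum.distrib flip: sum_distrib_left)
  also have "\<dots> \<le> 2 * (1 + S) * ((\<Sum>k<n. (y k)\<^sup>2) + (\<Sum>j<p. \<Sum>k<n. (y k)\<^sup>2))"
  proof (intro mult_left_mono add_mono sum_mono)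
    show "(\<Sum>k=p..<n. (y k)\<^sup>2) \<le> (\<Sum>k<n. (y k)\<^sup>2)" by (rule sum_mono2) auto
  qed (use S0 in \<open>auto intro: sum_shift_square_le\<close>)
  also have "\<dots> = 2 * (1 + S) * (1 + real p) * (\<Sum>k<n. (y k)\<^sup>2)"
    by (simp add: algebra_simps)
  finally show ?thesis by (simp only: S_def y_def)
qed

text \<open>
  Only second moments of the noise are available, so its empirical covariance is controlled from
  below through the truncated squares.
\<close>

definition noise_gram_dev :: "nat \<Rightarrow> real \<Rightarrow> (nat \<Rightarrow> real) \<Rightarrow> nat \<Rightarrow> real" where
  "noise_gram_dev p m e n =
     (\<Sum>i<p. (\<Sum>k=p..<n. min ((e (k - i))\<^sup>2) 1 - m)\<^sup>2) +
     (\<Sum>i<p. \<Sum>j\<in>{..<p} - {i}. (\<Sum>k=p..<n. e (k - i) * e (k - j))\<^sup>2)"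

lemma sum_square_le:
  fixes b :: "nat \<Rightarrow> real"
  shows "(\<Sum>i<p. \<bar>b i\<bar>)\<^sup>2 \<le> real p * (\<Sum>i<p. (b i)\<^sup>2)"
  using Cauchy_Schwarz_ineq_sum[of "\<lambda>_. 1" "\<lambda>i. \<bar>b i\<bar>" "{..<p}"] by simp

text \<open>Diagonal dominance of the empirical covariance \<open>C\<close>. A diagonal entry
  dominates its truncated sum, which is within \<open>h * real n\<close> of its mean; each
  off-diagonal entry is at most \<open>h * real n\<close>, and together they cost a factor
  \<open>p\<close>.\<close>

lemma noise_gram_lower_bound:
  assumes dev: "noise_gram_dev p m e n \<le> (h * real n)\<^sup>2" and h: "0 \<le> h" and n: "p \<le> n"
  shows "(real (n - p) * m - h * real n * (1 + real p)) * (\<Sum>i<p. (b i)\<^sup>2)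
    \<le> (\<Sum>k=p..<n. (\<Sum>i<p. b i * e (k - i))\<^sup>2)"
proof -
  define C where "C i j = (\<Sum>k=p..<n. e (k - i) * e (k - j))" for i j
  define T where "T i = (\<Sum>k=p..<n. min ((e (k - i))\<^sup>2) 1 - m)" for i
  have hn: "0 \<le> h * real n" using h by simp
  have T: "\<bar>T i\<bar> \<le> h * real n" if "i < p" for i
  proof -
    have "(T i)\<^sup>2 \<le> (\<Sum>i<p. (T i)\<^sup>2)" using that by (intro member_le_sum) auto
    also have "\<dots> \<le> noise_gram_dev p m e n"
      by (simp add: noise_gram_dev_def T_def sum_nonneg)
    finally have "(T i)\<^sup>2 \<le> (h * real n)\<^sup>2" using dev by linarith
    then show ?thesis using hn by (metis abs_le_square_iff abs_of_nonneg)
  qed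
  have Coff: "\<bar>C i j\<bar> \<le> h * real n" if "i < p" "j < p" "i \<noteq> j" for i j
  proof -
    have "(C i j)\<^sup>2 \<le> (\<Sum>j\<in>{..<p} - {i}. (C i j)\<^sup>2)" using that by (intro member_le_sum) auto
    also have "\<dots> \<le> (\<Sum>i<p. \<Sum>j\<in>{..<p} - {i}. (C i j)\<^sup>2)"
      using that by (intro member_le_sum[of i "{..<p}" "\<lambda>i. \<Sum>j\<in>{..<p} - {i}. (C i j)\<^sup>2"]) (auto intro: sum_nonneg)
    also have "\<dots> \<le> noise_gram_dev p m e n"
      by (simp add: noise_gram_dev_def C_def sum_nonneg)
    finally have "(C i j)\<^sup>2 \<le> (h * real n)\<^sup>2" using dev by linarith
    then show ?thesis using hn by (metis abs_le_square_iff abs_of_nonneg)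
  qed
  have Cdiag: "real (n - p) * m - h * real n \<le> C i i" if "i < p" for i
  proof -
    have "(\<Sum>k=p..<n. min ((e (k - i))\<^sup>2) 1) \<le> C i i"
      unfolding C_def by (rule sum_mono) (simp add: power2_eq_square)
    moreover have "T i = (\<Sum>k=p..<n. min ((e (k - i))\<^sup>2) 1) - real (n - p) * m"
      by (simp add: T_def sum_subtractf)
    ultimately show ?thesis using T[OF that] by linarith
  qed
  have "(\<Sum>k=p..<n. (\<Sum>i<p. b i * e (k - i))\<^sup>2)
      = (\<Sum>k=p..<n. \<Sum>i<p. \<Sum>j<p. b i * b j * (e (k - i) * e (k - j)))"
    by (simp add: power2_eq_square sum_product mult_ac)
  also have "\<dots> = (\<Sum>i<p. \<Sum>j<p. b i * b j * C i j)"
    unfolding C_def sum_distrib_left by (subst sum.swap, rule sum.cong[OF refl], rule sum.swap)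
  also have "\<dots> = (\<Sum>i<p. (b i)\<^sup>2 * C i i + (\<Sum>j\<in>{..<p} - {i}. b i * b j * C i j))"
    by (intro sum.cong refl) (simp add: sum.remove power2_eq_square)
  finally have eq: "(\<Sum>k=p..<n. (\<Sum>i<p. b i * e (k - i))\<^sup>2)
      = (\<Sum>i<p. (b i)\<^sup>2 * C i i) + (\<Sum>i<p. \<Sum>j\<in>{..<p} - {i}. b i * b j * C i j)"
    by (simp only: sum.distrib)
  have "(real (n - p) * m - h * real n) * (\<Sum>i<p. (b i)\<^sup>2) \<le> (\<Sum>i<p. (b i)\<^sup>2 * C i i)"
    unfolding sum_distrib_left
    by (rule sum_mono) (subst mult.commute, rule mult_left_mono, auto intro: Cdiag)
  moreover have "- (h * real n * (real p * (\<Sum>i<p. (b i)\<^sup>2))) \<le> (\<Sum>i<p. \<Sum>j\<in>{..<p} - {i}. b i * b j * C i j)"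
  proof -
    have "- (\<Sum>i<p. \<Sum>j\<in>{..<p} - {i}. b i * b j * C i j) \<le> (\<Sum>i<p. \<Sum>j\<in>{..<p} - {i}. \<bar>b i\<bar> * \<bar>b j\<bar> * (h * real n))"
      unfolding sum_negf[symmetric]
    proof (intro sum_mono)
      fix i j assume ij: "i \<in> {..<p}" "j \<in> {..<p} - {i}"
      have "- (b i * b j * C i j) \<le> \<bar>b i\<bar> * \<bar>b j\<bar> * \<bar>C i j\<bar>"
        by (metis abs_ge_minus_self abs_mult)
      also have "\<dots> \<le> \<bar>b i\<bar> * \<bar>b j\<bar> * (h * real n)"
        using ij by (intro mult_left_mono Coff) auto
      finally show "- (b i * b j * C i j) \<le> \<bar>b i\<bar> * \<bar>b j\<bar> * (h * real n)" .
    qed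
    also have "\<dots> \<le> (\<Sum>i<p. \<Sum>j<p. \<bar>b i\<bar> * \<bar>b j\<bar> * (h * real n))"
      using hn by (intro sum_mono sum_mono2) auto
    also have "\<dots> = h * real n * (\<Sum>i<p. \<bar>b i\<bar>)\<^sup>2"
      by (simp add: power2_eq_square sum_product sum_distrib_left sum_distrib_right mult_ac)
    also have "\<dots> \<le> h * real n * (real p * (\<Sum>i<p. (b i)\<^sup>2))"
      by (intro mult_left_mono sum_square_le hn)
    finally show ?thesis by linarith
  qed
  ultimately show ?thesis unfolding eq by (simp add: algebra_simps)
qed

section \<open>Upper bound for the score and the pathwise error estimate\<close>

text \<open>The combined process splits into a driven part and a homogeneous part. Cauchy-Schwarz
  handles the first; for the second the projection bound \<open>q\<close> is used, and its norm is
  estimated through the total minus the driven part, so the initial values enter the bound only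
  through the total energy.\<close>

lemma ar_score_bound:
  fixes x :: "int \<Rightarrow> real"
  assumes rec: "\<And>k. 1 \<le> k \<Longrightarrow> k \<le> n \<Longrightarrow> x (int k) = (\<Sum>j<p. a j * x (int k - 1 - int j)) + e k"
    and q0: "0 \<le> q"
    and q: "\<And>c. (\<Sum>k<n. e (Suc k) * (\<Sum>s\<in>{..<p} \<times> {..<p}. c s * ar_propagator p a k (fst s) (snd s)))\<^sup>2
      \<le> q * (\<Sum>k<n. (\<Sum>s\<in>{..<p} \<times> {..<p}. c s * ar_propagator p a k (fst s) (snd s))\<^sup>2)"
  defines "w \<equiv> driven p a n e"
  shows "(\<Sum>k<n. e (Suc k) * (\<Sum>i<p. b i * x (int k - int i)))
    \<le> sqrt (\<Sum>i<p. (b i)\<^sup>2) * sqrt (\<Sum>i<p. (\<Sum>k<n. e (Suc k) * w (int k - int i))\<^sup>2)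
      + sqrt q * (sqrt (\<Sum>k<n. (\<Sum>i<p. b i * x (int k - int i))\<^sup>2)
          + sqrt (\<Sum>i<p. (b i)\<^sup>2) * sqrt (\<Sum>i<p. \<Sum>k<n. (w (int k - int i))\<^sup>2))"
proof -
  \<comment> \<open>\<open>d\<close> solves the homogeneous recursion, so \<open>l\<close> lies in the span of \<open>p\<^sup>2\<close> sequences that
    depend only on \<open>a\<close>.\<close>
  define d where "d z = x z - w z" for z
  define y where "y k = (\<Sum>i<p. b i * x (int k - int i))" for k
  define v where "v k = (\<Sum>i<p. b i * w (int k - int i))" for k
  define l where "l k = (\<Sum>i<p. b i * d (int k - int i))" for k
  have d_rec: "d (int k) = (\<Sum>j<p. a j * d (int k - 1 - int j))" if "1 \<le> k" "k \<le> n" for k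
    using rec[OF that] driven_rec[OF that, of p a e]
    by (simp add: d_def w_def right_diff_distrib sum_subtractf)
  \<comment> \<open>All dependence on the initial values sits in these coefficients. They may vary
    with the path because the assumption on \<open>q\<close> is uniform in \<open>c\<close>.\<close>
  define c where "c s = b (fst s) * d (- int (snd s))" for s :: "nat \<times> nat"
  have l: "l k = (\<Sum>s\<in>{..<p} \<times> {..<p}. c s * ar_propagator p a k (fst s) (snd s))" if "k < n" for k
  proof -
    have "l k = (\<Sum>i<p. \<Sum>r<p. b i * (ar_propagator p a k i r * d (- int r)))"
      unfolding l_def
    proof (intro sum.cong refl)
      fix i assume "i \<in> {..<p}"
      then have "d (int k - int i) = (\<Sum>r<p. ar_propagator p a k i r * d (- int r))"
        using that by (intro ar_propagator_eq[where n = n]) (auto simp: d_rec)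
      then show "b i * d (int k - int i) = (\<Sum>r<p. b i * (ar_propagator p a k i r * d (- int r)))"
        by (simp add: sum_distrib_left)
    qed
    also have "\<dots> = (\<Sum>s\<in>{..<p} \<times> {..<p}. c s * ar_propagator p a k (fst s) (snd s))"
      by (simp add: sum.cartesian_product c_def case_prod_beta mult_ac)
    finally show ?thesis .
  qed
  have ylv: "y k = v k + l k" for k
    by (simp add: y_def v_def l_def d_def right_diff_distrib sum_subtractf)
  have "(\<Sum>k<n. e (Suc k) * v k) = (\<Sum>i<p. b i * (\<Sum>k<n. e (Suc k) * w (int k - int i)))"
    unfolding v_def sum_distrib_left by (subst sum.swap) (simp add: mult_ac)
  also have "\<dots> \<le> (\<Sum>i<p. \<bar>b i\<bar> * \<bar>\<Sum>k<n. e (Suc k) * w (int k - int i)\<bar>)"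
    by (rule sum_mono) (simp flip: abs_mult)
  also have "\<dots> \<le> sqrt (\<Sum>i<p. (b i)\<^sup>2) * sqrt (\<Sum>i<p. (\<Sum>k<n. e (Suc k) * w (int k - int i))\<^sup>2)"
    using L2_set_mult_ineq[of b "\<lambda>i. \<Sum>k<n. e (Suc k) * w (int k - int i)" "{..<p}"] by (simp add: L2_set_def)
  finally have ev: "(\<Sum>k<n. e (Suc k) * v k)
      \<le> sqrt (\<Sum>i<p. (b i)\<^sup>2) * sqrt (\<Sum>i<p. (\<Sum>k<n. e (Suc k) * w (int k - int i))\<^sup>2)" .
  have "(\<Sum>k<n. (v k)\<^sup>2) \<le> (\<Sum>k<n. (\<Sum>i<p. (b i)\<^sup>2) * (\<Sum>i<p. (w (int k - int i))\<^sup>2))"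
    unfolding v_def by (rule sum_mono) (rule Cauchy_Schwarz_ineq_sum)
  also have "\<dots> = (\<Sum>i<p. (b i)\<^sup>2) * (\<Sum>i<p. \<Sum>k<n. (w (int k - int i))\<^sup>2)"
    by (subst sum.swap) (simp flip: sum_distrib_left)
  finally have vn: "L2_set v {..<n} \<le> sqrt (\<Sum>i<p. (b i)\<^sup>2) * sqrt (\<Sum>i<p. \<Sum>k<n. (w (int k - int i))\<^sup>2)"
    unfolding L2_set_def real_sqrt_mult[symmetric] by (rule real_sqrt_le_mono)
  have "L2_set (\<lambda>k. y k + - v k) {..<n} \<le> L2_set y {..<n} + L2_set (\<lambda>k. - v k) {..<n}"
    by (rule L2_set_triangle_ineq)
  then have ln: "L2_set l {..<n} \<le> L2_set y {..<n} + L2_set v {..<n}"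
    by (simp add: ylv L2_set_def)
  have "(\<Sum>k<n. e (Suc k) * l k)\<^sup>2 \<le> q * (\<Sum>k<n. (l k)\<^sup>2)"
    using q[of c] by (simp add: l)
  then have "(\<Sum>k<n. e (Suc k) * l k) \<le> sqrt (q * (\<Sum>k<n. (l k)\<^sup>2))"
    by (rule real_le_rsqrt)
  also have "\<dots> = sqrt q * L2_set l {..<n}" by (simp add: L2_set_def real_sqrt_mult)
  also have "\<dots> \<le> sqrt q * (L2_set y {..<n} + L2_set v {..<n})"
    using q0 ln by (intro mult_left_mono) auto
  also have "\<dots> \<le> sqrt q * (L2_set y {..<n} +
      sqrt (\<Sum>i<p. (b i)\<^sup>2) * sqrt (\<Sum>i<p. \<Sum>k<n. (w (int k - int i))\<^sup>2))"
    using q0 vn by (intro mult_left_mono) auto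
  finally have el: "(\<Sum>k<n. e (Suc k) * l k) \<le> sqrt q * (L2_set y {..<n} +
      sqrt (\<Sum>i<p. (b i)\<^sup>2) * sqrt (\<Sum>i<p. \<Sum>k<n. (w (int k - int i))\<^sup>2))" .
  have "(\<Sum>k<n. e (Suc k) * y k) = (\<Sum>k<n. e (Suc k) * v k) + (\<Sum>k<n. e (Suc k) * l k)"
    by (simp add: ylv algebra_simps sum.distrib)
  then show ?thesis using ev el by (simp add: y_def[symmetric] L2_set_def)
qed

text \<open>In the application \<open>N\<close> is the norm of the error and \<open>s\<close> that
  of the combined process. Replacing \<open>N\<close> by \<open>s / g\<close> on the right leaves
  one factor \<open>s\<close> to cancel, and \<open>N \<le> s / g\<close> finishes.\<close>

lemma quadratic_bound:
  fixes N s g \<alpha> \<beta> \<gamma> :: real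
  assumes "s\<^sup>2 \<le> N * \<alpha> + \<gamma> * (s + N * \<beta>)" and g: "0 < g" and "(g * N)\<^sup>2 \<le> s\<^sup>2"
    and nn: "0 \<le> N" "0 \<le> s" "0 \<le> \<alpha>" "0 \<le> \<beta>" "0 \<le> \<gamma>"
  shows "N \<le> (\<alpha> + \<gamma> * \<beta>) / g\<^sup>2 + \<gamma> / g"
proof (cases "s = 0")
  case True
  then have "N = 0" using assms(3) g by auto
  then show ?thesis using nn g by simp
next
  case False
  then have s: "s > 0" using nn by simp
  have gN: "g * N \<le> s" using assms(3) nn(2) by (rule power2_le_imp_le)
  then have N: "N \<le> s / g" using g by (simp add: field_simps)
  have "s\<^sup>2 \<le> N * (\<alpha> + \<gamma> * \<beta>) + \<gamma> * s" using assms(1) by (simp add: algebra_simps)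
  also have "\<dots> \<le> s / g * (\<alpha> + \<gamma> * \<beta>) + \<gamma> * s"
    using N nn by (intro add_right_mono mult_right_mono) auto
  finally have "s * s \<le> s * ((\<alpha> + \<gamma> * \<beta>) / g + \<gamma>)"
    by (simp add: power2_eq_square algebra_simps add_divide_distrib)
  then have "s \<le> (\<alpha> + \<gamma> * \<beta>) / g + \<gamma>" using s by simp
  then have "s / g \<le> ((\<alpha> + \<gamma> * \<beta>) / g + \<gamma>) / g" using g by (intro divide_right_mono) auto
  with N show ?thesis by (simp add: add_divide_distrib power2_eq_square)
qed

text \<open>Positivity of the quadratic form makes the Gram matrix invertible, so the default value
  of the estimator does not occur. The Gram matrix then maps the error to the regressors weighted by
  the noise, and pairing with the error gives the identity.\<close>

lemma ols_normal_equation: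
  fixes x :: "int \<Rightarrow> real" and \<theta> :: "real vec"
  assumes th: "\<theta> \<in> carrier_vec p"
    and rec: "\<And>k. 1 \<le> k \<Longrightarrow> k \<le> n \<Longrightarrow> x (int k) = (\<Sum>j<p. \<theta> $ j * x (int k - 1 - int j)) + e k"
    and pos: "\<And>b. (\<exists>i<p. b i \<noteq> 0) \<Longrightarrow> (\<Sum>k<n. (\<Sum>i<p. b i * x (int k - int i))\<^sup>2) > 0"
  defines "\<delta> \<equiv> ols_estimator p x n - \<theta>"
  shows "(\<Sum>k<n. (\<Sum>i<p. \<delta> $ i * x (int k - int i))\<^sup>2)
      = (\<Sum>k<n. e (Suc k) * (\<Sum>i<p. \<delta> $ i * x (int k - int i)))"
    and "dim_vec \<delta> = p"
proof -
  define G where "G = gram_mat p x n"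
  have Gc: "G \<in> carrier_mat p p" by (simp add: G_def gram_mat_def)
  have Gmult: "(G *\<^sub>v u) $ i = (\<Sum>k<n. x (int k - int i) * (\<Sum>j<p. u $ j * x (int k - int j)))"
    if "u \<in> carrier_vec p" "i < p" for u i
  proof -
    have "(G *\<^sub>v u) $ i = (\<Sum>j<p. (\<Sum>k<n. x (int k - int i) * x (int k - int j)) * u $ j)"
      using that by (simp add: G_def gram_mat_def lag_vec_def scalar_prod_def atLeast0LessThan)
    also have "\<dots> = (\<Sum>k<n. \<Sum>j<p. x (int k - int i) * x (int k - int j) * u $ j)"
      unfolding sum_distrib_right by (rule sum.swap)
    also have "\<dots> = (\<Sum>k<n. x (int k - int i) * (\<Sum>j<p. u $ j * x (int k - int j)))"
      by (simp add: sum_distrib_left mult_ac)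
    finally show ?thesis .
  qed
  have quad: "(\<Sum>i<p. u $ i * (G *\<^sub>v u) $ i) = (\<Sum>k<n. (\<Sum>i<p. u $ i * x (int k - int i))\<^sup>2)"
    if u: "u \<in> carrier_vec p" for u
  proof -
    have "(\<Sum>i<p. u $ i * (G *\<^sub>v u) $ i)
        = (\<Sum>i<p. \<Sum>k<n. u $ i * x (int k - int i) * (\<Sum>j<p. u $ j * x (int k - int j)))"
      by (intro sum.cong refl) (simp add: Gmult[OF u] sum_distrib_left mult.assoc del: index_mult_mat_vec)
    also have "\<dots> = (\<Sum>k<n. (\<Sum>i<p. u $ i * x (int k - int i))\<^sup>2)"
      by (subst sum.swap) (simp add: power2_eq_square sum_distrib_right)
    finally show ?thesis .
  qed
  have "Determinant.det G \<noteq> 0"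
  proof
    assume "Determinant.det G = 0"
    then obtain u where u: "u \<in> carrier_vec p" "u \<noteq> 0\<^sub>v p" "G *\<^sub>v u = 0\<^sub>v p"
      using det_0_iff_vec_prod_zero[OF Gc] by auto
    have "\<exists>i<p. u $ i \<noteq> 0"
    proof (rule ccontr)
      assume "\<not> ?thesis"
      then have "u = 0\<^sub>v p" using u(1) by (intro eq_vecI) auto
      with u(2) show False by simp
    qed
    from pos[OF this] have "(\<Sum>i<p. u $ i * (G *\<^sub>v u) $ i) > 0" by (simp add: quad[OF u(1)] del: index_mult_mat_vec)
    moreover have "(\<Sum>i<p. u $ i * (G *\<^sub>v u) $ i) = 0" unfolding u(3) by simp
    ultimately show False by simp
  qed
  then have "G \<in> Units (ring_mat TYPE(real) p ())"
    by (rule det_non_zero_imp_unit[OF Gc])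
  then obtain B where B: "mat_inverse G = Some B"
    using mat_inverse(1)[OF Gc, where b = "()"] by (cases "mat_inverse G") auto
  have GB: "G * B = 1\<^sub>m p" "B \<in> carrier_mat p p" using mat_inverse(2)[OF Gc B] by auto
  have cc: "cross_vec p x n \<in> carrier_vec p" by (simp add: cross_vec_def)
  have ols: "ols_estimator p x n = B *\<^sub>v cross_vec p x n"
    using B by (simp add: ols_estimator_def G_def)
  then have oc: "ols_estimator p x n \<in> carrier_vec p" using GB(2) cc by auto
  have dc: "\<delta> \<in> carrier_vec p" using oc th by (simp add: \<delta>_def)
  then show "dim_vec \<delta> = p" by simp
  have "G *\<^sub>v ols_estimator p x n = cross_vec p x n"
    unfolding ols using Gc GB cc by (simp flip: assoc_mult_mat_vec)
  moreover have "G *\<^sub>v \<delta> = G *\<^sub>v ols_estimator p x n - G *\<^sub>v \<theta>"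
    unfolding \<delta>_def using Gc oc th by (rule mult_minus_distrib_mat_vec)
  ultimately have Gd: "G *\<^sub>v \<delta> = cross_vec p x n - G *\<^sub>v \<theta>" by simp
  have Gdi: "(G *\<^sub>v \<delta>) $ i = (\<Sum>k<n. x (int k - int i) * e (Suc k))" if i: "i < p" for i
  proof -
    have "cross_vec p x n $ i = (\<Sum>k<n. x (int k - int i) * x (int (Suc k)))"
      using i by (simp add: cross_vec_def lag_vec_def sum.atLeast1_atMost_eq)
    also have "\<dots> = (\<Sum>k<n. x (int k - int i) * ((\<Sum>j<p. \<theta> $ j * x (int k - int j)) + e (Suc k)))"
      by (intro sum.cong refl) (subst rec, auto)
    also have "\<dots> = (G *\<^sub>v \<theta>) $ i + (\<Sum>k<n. x (int k - int i) * e (Suc k))"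
      by (simp add: Gmult[OF th i] algebra_simps sum.distrib del: index_mult_mat_vec)
    finally have cr: "cross_vec p x n $ i = (G *\<^sub>v \<theta>) $ i + (\<Sum>k<n. x (int k - int i) * e (Suc k))" .
    have "(G *\<^sub>v \<delta>) $ i = cross_vec p x n $ i - (G *\<^sub>v \<theta>) $ i"
      unfolding Gd using i Gc by (intro index_minus_vec) auto
    then show ?thesis by (simp add: cr del: index_mult_mat_vec)
  qed
  have "(\<Sum>k<n. (\<Sum>i<p. \<delta> $ i * x (int k - int i))\<^sup>2) = (\<Sum>i<p. \<delta> $ i * (G *\<^sub>v \<delta>) $ i)"
    by (rule quad[OF dc, symmetric])
  also have "\<dots> = (\<Sum>i<p. \<Sum>k<n. e (Suc k) * (\<delta> $ i * x (int k - int i)))"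
    by (intro sum.cong refl) (simp add: Gdi sum_distrib_left mult_ac del: index_mult_mat_vec)
  also have "\<dots> = (\<Sum>k<n. e (Suc k) * (\<Sum>i<p. \<delta> $ i * x (int k - int i)))"
    unfolding sum_distrib_left by (rule sum.swap)
  finally show "(\<Sum>k<n. (\<Sum>i<p. \<delta> $ i * x (int k - int i))\<^sup>2)
      = (\<Sum>k<n. e (Suc k) * (\<Sum>i<p. \<delta> $ i * x (int k - int i)))" .
qed

text \<open>For a fixed path, \<open>lower\<close> gives a curvature of at least
  \<open>\<kappa> * real n\<close> and \<open>ar_score_bound\<close> limits the score;
  \<open>quadratic_bound\<close> combines the two. Randomness enters only later, when the quantities
  bounded by \<open>\<eta>\<close> are estimated in mean.\<close>

lemma ols_error_pathwise:
  fixes x :: "int \<Rightarrow> real" and \<theta> :: "real vec" and e :: "nat \<Rightarrow> real"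
  assumes th: "\<theta> \<in> carrier_vec p"
    and rec: "\<And>k. 1 \<le> k \<Longrightarrow> k \<le> n \<Longrightarrow> x (int k) = (\<Sum>j<p. \<theta> $ j * x (int k - 1 - int j)) + e k"
    and n: "1 \<le> n" "4 * p \<le> n" and m: "0 < m"
    and S: "(\<Sum>j<p. (\<theta> $ j)\<^sup>2) \<le> S"
    and q0: "0 \<le> q"
    and q: "\<And>c. (\<Sum>k<n. e (Suc k) * (\<Sum>s\<in>{..<p} \<times> {..<p}. c s * ar_propagator p (\<lambda>j. \<theta> $ j) k (fst s) (snd s)))\<^sup>2
      \<le> q * (\<Sum>k<n. (\<Sum>s\<in>{..<p} \<times> {..<p}. c s * ar_propagator p (\<lambda>j. \<theta> $ j) k (fst s) (snd s))\<^sup>2)"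
    and score: "(\<Sum>i<p. (\<Sum>k<n. e (Suc k) * driven p (\<lambda>j. \<theta> $ j) n e (int k - int i))\<^sup>2) \<le> \<eta> * (real n)\<^sup>2"
    and qn: "q \<le> \<eta> * real n" and t: "0 < t"
    and energy: "t * q + (\<Sum>i<p. \<Sum>k<n. (driven p (\<lambda>j. \<theta> $ j) n e (int k - int i))\<^sup>2) / ((real n)\<^sup>2 * t) \<le> \<eta>"
    and dev: "noise_gram_dev p m e n \<le> \<eta> * (real n)\<^sup>2"
    and eta: "0 \<le> \<eta>" "sqrt \<eta> \<le> m / (4 * (1 + real p))"
    and kap: "\<kappa> = m / (4 * (1 + S) * (1 + real p))"
  shows "eucl_norm (ols_estimator p x n - \<theta>) \<le> (sqrt \<eta> + \<eta>) / \<kappa> + sqrt \<eta> / sqrt \<kappa>"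
proof -
  define y where "y b k = (\<Sum>i<p. b i * x (int k - int i))" for b :: "nat \<Rightarrow> real" and k
  have S0: "0 \<le> S" using S by (meson order_trans sum_nonneg zero_le_power2)
  have kap0: "0 < \<kappa>" using m S0 by (simp add: kap)
  have np: "real n > 0" "real n \<ge> 4 * real p" using n of_nat_mono[OF n(2), where 'a = real] by auto
  have lower: "\<kappa> * real n * (\<Sum>i<p. (b i)\<^sup>2) \<le> (\<Sum>k<n. (y b k)\<^sup>2)" for b
  proof -
    define B where "B = (\<Sum>i<p. (b i)\<^sup>2)"
    \<comment> \<open>Chosen so that the deviations cost a quarter of \<open>m * real n\<close>. The
      condition \<open>4 * p \<le> n\<close> leaves at least three quarters of the mean, hence half
      remains, and division by the filter constant yields \<open>\<kappa>\<close>.\<close>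
    define h where "h = m / (4 * (1 + real p))"
    have h: "0 \<le> h" "h * (1 + real p) = m / 4" using m by (auto simp: h_def field_simps add_nonneg_eq_0_iff)
    have "noise_gram_dev p m e n \<le> (h * real n)\<^sup>2"
    proof -
      have "\<eta> = (sqrt \<eta>)\<^sup>2" using eta by simp
      also have "\<dots> \<le> h\<^sup>2" using eta by (intro power_mono) (auto simp: h_def)
      finally have "\<eta> * (real n)\<^sup>2 \<le> h\<^sup>2 * (real n)\<^sup>2" by (rule mult_right_mono) simp
      then show ?thesis using dev by (simp add: power_mult_distrib)
    qed
    from noise_gram_lower_bound[OF this h(1), of b] n
    have "(real (n - p) * m - h * real n * (1 + real p)) * B \<le> (\<Sum>k=p..<n. (\<Sum>i<p. b i * e (k - i))\<^sup>2)"
      by (simp add: B_def)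
    moreover have "m / 2 * real n * B \<le> (real (n - p) * m - h * real n * (1 + real p)) * B"
    proof (rule mult_right_mono)
      have "real (n - p) \<ge> 3 / 4 * real n" using np n by (simp add: of_nat_diff)
      then have "3 / 4 * real n * m \<le> real (n - p) * m" using m by (intro mult_right_mono) auto
      moreover have "h * real n * (1 + real p) = m / 4 * real n" using h(2) by (simp add: mult_ac)
      moreover have "m / 2 * real n = 3 / 4 * real n * m - m / 4 * real n" by (simp add: algebra_simps)
      ultimately show "m / 2 * real n \<le> real (n - p) * m - h * real n * (1 + real p)" by linarith
      show "0 \<le> B" by (simp add: B_def sum_nonneg)
    qed
    moreover have "(\<Sum>k=p..<n. (\<Sum>i<p. b i * e (k - i))\<^sup>2)
        \<le> 2 * (1 + (\<Sum>j<p. (\<theta> $ j)\<^sup>2)) * (1 + real p) * (\<Sum>k<n. (y b k)\<^sup>2)"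
      unfolding y_def by (rule ar_filter_bound) (rule rec)
    moreover have "\<dots> \<le> 2 * (1 + S) * (1 + real p) * (\<Sum>k<n. (y b k)\<^sup>2)"
      using S by (intro mult_right_mono) (auto intro: sum_nonneg)
    ultimately have "m / 2 * real n * B \<le> 2 * (1 + S) * (1 + real p) * (\<Sum>k<n. (y b k)\<^sup>2)" by linarith
    then have "m / 2 * real n * B / (2 * (1 + S) * (1 + real p)) \<le> (\<Sum>k<n. (y b k)\<^sup>2)"
      using S0 by (subst pos_divide_le_eq) (auto simp: mult_ac)
    moreover have "m / 2 * real n * B / (2 * (1 + S) * (1 + real p)) = \<kappa> * real n * B"
      by (simp add: kap)
    ultimately show ?thesis by (simp add: B_def)
  qed
  define \<delta> where "\<delta> = ols_estimator p x n - \<theta>"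
  have pos: "(\<Sum>k<n. (\<Sum>i<p. b i * x (int k - int i))\<^sup>2) > 0" if "\<exists>i<p. b i \<noteq> 0" for b
  proof -
    have "(\<Sum>i<p. (b i)\<^sup>2) > 0" using that by (auto intro!: sum_pos2)
    then have "\<kappa> * real n * (\<Sum>i<p. (b i)\<^sup>2) > 0" using kap0 np by simp
    with lower[of b] show ?thesis by (simp add: y_def)
  qed
  note ne = ols_normal_equation[OF th rec pos, folded \<delta>_def]
  define N where "N = sqrt (\<Sum>i<p. (\<delta> $ i)\<^sup>2)"
  define s where "s = sqrt (\<Sum>k<n. (y (\<lambda>i. \<delta> $ i) k)\<^sup>2)"
  define \<alpha> where "\<alpha> = sqrt (\<Sum>i<p. (\<Sum>k<n. e (Suc k) * driven p (\<lambda>j. \<theta> $ j) n e (int k - int i))\<^sup>2)"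
  define \<beta> where "\<beta> = sqrt (\<Sum>i<p. \<Sum>k<n. (driven p (\<lambda>j. \<theta> $ j) n e (int k - int i))\<^sup>2)"
  have "s\<^sup>2 = (\<Sum>k<n. (y (\<lambda>i. \<delta> $ i) k)\<^sup>2)" by (simp add: s_def sum_nonneg)
  also have "\<dots> = (\<Sum>k<n. e (Suc k) * y (\<lambda>i. \<delta> $ i) k)" using ne(1) by (simp add: y_def)
  also have "\<dots> \<le> N * \<alpha> + sqrt q * (s + N * \<beta>)"
    using ar_score_bound[OF rec q0 q, where b = "\<lambda>i. \<delta> $ i"]
    by (simp add: y_def N_def \<alpha>_def \<beta>_def s_def)
  finally have s2: "s\<^sup>2 \<le> N * \<alpha> + sqrt q * (s + N * \<beta>)" .
  define g where "g = sqrt (\<kappa> * real n)"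
  have g0: "0 < g" using kap0 np by (simp add: g_def)
  have g2: "g\<^sup>2 = \<kappa> * real n" using kap0 by (simp add: g_def)
  have "(g * N)\<^sup>2 \<le> s\<^sup>2"
    using lower[of "\<lambda>i. \<delta> $ i"] by (simp add: power_mult_distrib g2 N_def s_def sum_nonneg)
  from quadratic_bound[OF s2 g0 this]
  have "N \<le> (\<alpha> + sqrt q * \<beta>) / g\<^sup>2 + sqrt q / g"
    using q0 by (simp add: N_def s_def \<alpha>_def \<beta>_def sum_nonneg)
  also have "\<dots> \<le> (sqrt \<eta> * real n + \<eta> * real n) / g\<^sup>2 + sqrt (\<eta> * real n) / g"
  proof (intro add_mono divide_right_mono)
    have "\<alpha> \<le> sqrt (\<eta> * (real n)\<^sup>2)" unfolding \<alpha>_def by (rule real_sqrt_le_mono) (rule score)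
    then show "\<alpha> \<le> sqrt \<eta> * real n" by (simp add: real_sqrt_mult)
    have b2: "\<beta>\<^sup>2 = (\<Sum>i<p. \<Sum>k<n. (driven p (\<lambda>j. \<theta> $ j) n e (int k - int i))\<^sup>2)"
      by (simp add: \<beta>_def sum_nonneg)
    have b0: "0 \<le> \<beta>" by (simp add: \<beta>_def sum_nonneg)
    \<comment> \<open>The weight \<open>t\<close> splits the product of \<open>sqrt q\<close> and
      \<open>\<beta>\<close> into a sum, whose expectation can later be taken term by term although
      the two factors are dependent.\<close>
    have "sqrt q * (\<beta> / real n) = (sqrt t * sqrt q) * (\<beta> / real n / sqrt t)"
      using t by simp
    also have "\<dots> \<le> (sqrt t * sqrt q)\<^sup>2 + (\<beta> / real n / sqrt t)\<^sup>2"
    proof -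
      have *: "u * v \<le> u\<^sup>2 + v\<^sup>2" if "0 \<le> u" "0 \<le> v" for u v :: real
        using sum_squares_bound[of u v] mult_nonneg_nonneg[OF that] by linarith
      show ?thesis using t q0 b0 by (intro *) auto
    qed
    also have "\<dots> = t * q + \<beta>\<^sup>2 / ((real n)\<^sup>2 * t)"
      using t q0 by (simp add: power_mult_distrib power_divide)
    also have "\<dots> \<le> \<eta>" using energy by (simp add: b2)
    finally have "sqrt q * (\<beta> / real n) * real n \<le> \<eta> * real n" using np by (intro mult_right_mono) auto
    then show "sqrt q * \<beta> \<le> \<eta> * real n" using np by simp
    show "sqrt q \<le> sqrt (\<eta> * real n)" by (rule real_sqrt_le_mono) (rule qn)
  qed (use g0 in auto)
  also have "\<dots> = (sqrt \<eta> + \<eta>) / \<kappa> + sqrt \<eta> / sqrt \<kappa>"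
  proof -
    have "(sqrt \<eta> * real n + \<eta> * real n) / g\<^sup>2 = (sqrt \<eta> + \<eta>) / \<kappa>"
      using np kap0 by (simp add: g2 flip: distrib_right)
    moreover have "sqrt (\<eta> * real n) / g = sqrt \<eta> / sqrt \<kappa>"
      using np by (simp add: g_def real_sqrt_mult)
    ultimately show ?thesis by simp
  qed
  finally have "N \<le> (sqrt \<eta> + \<eta>) / \<kappa> + sqrt \<eta> / sqrt \<kappa>" .
  moreover have "eucl_norm \<delta> = N" by (simp add: eucl_norm_def N_def ne(2))
  ultimately show ?thesis by (simp add: \<delta>_def)
qed

section \<open>Moments of the noise\<close>

lemma (in prob_space) orthogonal_sum_square:
  fixes f :: "'i \<Rightarrow> 'a \<Rightarrow> real"
  assumes fin: "finite I"
    and int: "\<And>i j. i \<in> I \<Longrightarrow> j \<in> I \<Longrightarrow> integrable M (\<lambda>\<omega>. f i \<omega> * f j \<omega>)"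
    and orth: "\<And>i j. i \<in> I \<Longrightarrow> j \<in> I \<Longrightarrow>
        expectation (\<lambda>\<omega>. f i \<omega> * f j \<omega>) = (if i = j then s else 0)"
  shows "integrable M (\<lambda>\<omega>. (\<Sum>i\<in>I. c i * f i \<omega>)\<^sup>2)"
    and "expectation (\<lambda>\<omega>. (\<Sum>i\<in>I. c i * f i \<omega>)\<^sup>2) = s * (\<Sum>i\<in>I. (c i)\<^sup>2)"
proof -
  have eq: "(\<Sum>i\<in>I. c i * f i \<omega>)\<^sup>2 = (\<Sum>i\<in>I. \<Sum>j\<in>I. c i * c j * (f i \<omega> * f j \<omega>))" for \<omega>
    by (simp add: power2_eq_square sum_product mult_ac)
  show "integrable M (\<lambda>\<omega>. (\<Sum>i\<in>I. c i * f i \<omega>)\<^sup>2)"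
    unfolding eq by (intro Bochner_Integration.integrable_sum integrable_mult_right int)
  have "expectation (\<lambda>\<omega>. (\<Sum>i\<in>I. c i * f i \<omega>)\<^sup>2)
      = (\<Sum>i\<in>I. \<Sum>j\<in>I. c i * c j * expectation (\<lambda>\<omega>. f i \<omega> * f j \<omega>))"
    unfolding eq
    by (subst Bochner_Integration.integral_sum;
        (intro Bochner_Integration.integrable_sum integrable_mult_right int sum.cong refl)?; assumption?)
       (subst Bochner_Integration.integral_sum;
        (intro integrable_mult_right int sum.cong refl)?; simp)
  also have "\<dots> = (\<Sum>i\<in>I. \<Sum>j\<in>I. if i = j then s * (c i)\<^sup>2 else 0)"
    by (intro sum.cong refl) (simp add: orth power2_eq_square)
  also have "\<dots> = s * (\<Sum>i\<in>I. (c i)\<^sup>2)" using fin by (simp add: sum_distrib_left)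
  finally show "expectation (\<lambda>\<omega>. (\<Sum>i\<in>I. c i * f i \<omega>)\<^sup>2) = s * (\<Sum>i\<in>I. (c i)\<^sup>2)" .
qed

context triangular_ar
begin

lemma noise_measurable [measurable]: "k \<ge> 1 \<Longrightarrow> \<epsilon> k \<in> borel_measurable M"
  using noise_indep by (auto simp: indep_vars_def)

lemma noise_ident_integral:
  fixes f :: "real \<Rightarrow> real"
  assumes k: "k \<ge> 1" and [measurable]: "f \<in> borel_measurable borel"
  shows "integrable M (\<lambda>\<omega>. f (\<epsilon> k \<omega>)) \<longleftrightarrow> integrable M (\<lambda>\<omega>. f (\<epsilon> 1 \<omega>))"
    and "expectation (\<lambda>\<omega>. f (\<epsilon> k \<omega>)) = expectation (\<lambda>\<omega>. f (\<epsilon> 1 \<omega>))"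
proof -
  have [measurable]: "\<epsilon> k \<in> borel_measurable M" "\<epsilon> 1 \<in> borel_measurable M"
    using k noise_measurable by auto
  show "integrable M (\<lambda>\<omega>. f (\<epsilon> k \<omega>)) \<longleftrightarrow> integrable M (\<lambda>\<omega>. f (\<epsilon> 1 \<omega>))"
    using integrable_distr_eq[of "\<epsilon> k" M borel f] integrable_distr_eq[of "\<epsilon> 1" M borel f]
      noise_ident[OF k] by simp
  show "expectation (\<lambda>\<omega>. f (\<epsilon> k \<omega>)) = expectation (\<lambda>\<omega>. f (\<epsilon> 1 \<omega>))"
    using integral_distr[of "\<epsilon> k" M borel f] integral_distr[of "\<epsilon> 1" M borel f]
      noise_ident[OF k] by simp
qed

lemma noise_prod_expectation:
  fixes f :: "nat \<Rightarrow> real \<Rightarrow> real"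
  assumes I: "finite I" "I \<subseteq> {1..}"
    and f: "\<And>i. f i \<in> borel_measurable borel"
    and int: "\<And>i. i \<in> I \<Longrightarrow> integrable M (\<lambda>\<omega>. f i (\<epsilon> 1 \<omega>))"
  shows "integrable M (\<lambda>\<omega>. \<Prod>i\<in>I. f i (\<epsilon> i \<omega>))"
    and "expectation (\<lambda>\<omega>. \<Prod>i\<in>I. f i (\<epsilon> i \<omega>)) = (\<Prod>i\<in>I. expectation (\<lambda>\<omega>. f i (\<epsilon> 1 \<omega>)))"
proof -
  have "indep_vars (\<lambda>_. borel) \<epsilon> I" using noise_indep I(2) by (rule indep_vars_subset)
  then have ind: "indep_vars (\<lambda>_. borel) (\<lambda>i \<omega>. f i (\<epsilon> i \<omega>)) I"
    using f by (rule indep_vars_compose2)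
  have int': "integrable M (\<lambda>\<omega>. f i (\<epsilon> i \<omega>))" if "i \<in> I" for i
    using noise_ident_integral(1)[of i "f i"] int[OF that] f that I by auto
  show "integrable M (\<lambda>\<omega>. \<Prod>i\<in>I. f i (\<epsilon> i \<omega>))"
    by (rule indep_vars_integrable[OF I(1) ind int'])
  have "expectation (\<lambda>\<omega>. \<Prod>i\<in>I. f i (\<epsilon> i \<omega>)) = (\<Prod>i\<in>I. expectation (\<lambda>\<omega>. f i (\<epsilon> i \<omega>)))"
    by (rule indep_vars_lebesgue_integral[OF I(1) ind int'])
  also have "\<dots> = (\<Prod>i\<in>I. expectation (\<lambda>\<omega>. f i (\<epsilon> 1 \<omega>)))"
    using f I by (intro prod.cong noise_ident_integral(2)) auto
  finally show "expectation (\<lambda>\<omega>. \<Prod>i\<in>I. f i (\<epsilon> i \<omega>)) = (\<Prod>i\<in>I. expectation (\<lambda>\<omega>. f i (\<epsilon> 1 \<omega>)))" .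
qed

lemma noise_pow_integrable: "e \<le> 2 \<Longrightarrow> integrable M (\<lambda>\<omega>. (\<epsilon> 1 \<omega>) ^ e)"
proof -
  assume "e \<le> 2"
  then have "e = 0 \<or> e = 1 \<or> e = 2" by auto
  then show ?thesis using noise_integrable noise_square_integrable by auto
qed

lemma prod_pow_indicator:
  fixes x :: "nat \<Rightarrow> real"
  assumes "finite I" "j \<in> I"
  shows "(\<Prod>i\<in>I. x i ^ of_bool (i = j)) = x j"
proof -
  have "(\<Prod>i\<in>I. x i ^ of_bool (i = j)) = (\<Prod>i\<in>I. if i = j then x i else 1)"
    by (rule prod.cong) auto
  then show ?thesis using assms by simp
qed

text \<open>The exponent \<open>e i\<close> counts the occurrences of index \<open>i\<close>. Since
  each pair is strictly ordered, none occurs more than twice and second moments suffice. If the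
  pairs differ, some index occurs exactly once and contributes the mean zero.\<close>

lemma noise_pair_moment:
  assumes jk: "1 \<le> j" "j < k" and lm: "1 \<le> l" "l < m"
  shows "integrable M (\<lambda>\<omega>. (\<epsilon> j \<omega> * \<epsilon> k \<omega>) * (\<epsilon> l \<omega> * \<epsilon> m \<omega>))" (is ?int)
    and "expectation (\<lambda>\<omega>. (\<epsilon> j \<omega> * \<epsilon> k \<omega>) * (\<epsilon> l \<omega> * \<epsilon> m \<omega>))
      = (if (j, k) = (l, m) then \<sigma> ^ 4 else 0)" (is ?exp)
proof -
  define I where "I = {j, k, l, m}"
  define e :: "nat \<Rightarrow> nat" where
    "e i = of_bool (i = j) + of_bool (i = k) + of_bool (i = l) + of_bool (i = m)" for i
  have e2: "e i \<le> 2" for i using jk lm by (auto simp: e_def)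
  have I: "finite I" "I \<subseteq> {1..}" using jk lm by (auto simp: I_def)
  have eq: "(\<epsilon> j \<omega> * \<epsilon> k \<omega>) * (\<epsilon> l \<omega> * \<epsilon> m \<omega>) = (\<Prod>i\<in>I. \<epsilon> i \<omega> ^ e i)" for \<omega>
  proof -
    have "(\<Prod>i\<in>I. \<epsilon> i \<omega> ^ e i) = (\<Prod>i\<in>I. \<epsilon> i \<omega> ^ of_bool (i = j)) * (\<Prod>i\<in>I. \<epsilon> i \<omega> ^ of_bool (i = k))
       * (\<Prod>i\<in>I. \<epsilon> i \<omega> ^ of_bool (i = l)) * (\<Prod>i\<in>I. \<epsilon> i \<omega> ^ of_bool (i = m))"
      unfolding e_def power_add prod.distrib ..
    also have "\<dots> = \<epsilon> j \<omega> * \<epsilon> k \<omega> * \<epsilon> l \<omega> * \<epsilon> m \<omega>"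
      using I(1) by (subst (1 2 3 4) prod_pow_indicator) (auto simp: I_def)
    finally show ?thesis by (simp add: mult_ac)
  qed
  note P = noise_prod_expectation[OF I, of "\<lambda>i x. x ^ e i", OF _ noise_pow_integrable[OF e2]]
  show ?int unfolding eq by (rule P(1)) measurable
  have E: "expectation (\<lambda>\<omega>. (\<epsilon> j \<omega> * \<epsilon> k \<omega>) * (\<epsilon> l \<omega> * \<epsilon> m \<omega>))
      = (\<Prod>i\<in>I. expectation (\<lambda>\<omega>. \<epsilon> 1 \<omega> ^ e i))"
    unfolding eq by (rule P(2)) measurable
  show ?exp
  proof (cases "(j, k) = (l, m)")
    case True
    then have "I = {j, k}" "e j = 2" "e k = 2" using jk by (auto simp: I_def e_def)
    then show ?thesis using jk True unfolding E
      by (simp add: noise_second_moment del: One_nat_def flip: power_add)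
  next
    case False
    have "\<exists>i\<in>I. e i = 1"
    proof (cases "j \<in> {l, m}")
      case True
      then have "e k = 1" using jk lm False by (auto simp: e_def)
      then show ?thesis by (auto simp: I_def)
    next
      case False
      then have "e j = 1" using jk by (auto simp: e_def)
      then show ?thesis by (auto simp: I_def)
    qed
    then obtain i where i: "i \<in> I" "e i = 1" by blast
    have "expectation (\<lambda>\<omega>. \<epsilon> 1 \<omega> ^ e i) = 0" unfolding i(2) using noise_mean by simp
    then have "(\<Prod>i\<in>I. expectation (\<lambda>\<omega>. \<epsilon> 1 \<omega> ^ e i)) = 0"
      by (intro prod_zero I(1) bexI[of _ i] i(1))
    then show ?thesis using False unfolding E by auto
  qed
qed

lemma noise_pair_sum_square:
  assumes "finite P" "\<And>j k. (j, k) \<in> P \<Longrightarrow> 1 \<le> j \<and> j < k"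
  shows "integrable M (\<lambda>\<omega>. (\<Sum>(j, k)\<in>P. c j k * (\<epsilon> j \<omega> * \<epsilon> k \<omega>))\<^sup>2)"
    and "expectation (\<lambda>\<omega>. (\<Sum>(j, k)\<in>P. c j k * (\<epsilon> j \<omega> * \<epsilon> k \<omega>))\<^sup>2)
      = \<sigma> ^ 4 * (\<Sum>(j, k)\<in>P. (c j k)\<^sup>2)"
proof -
  let ?f = "\<lambda>q \<omega>. \<epsilon> (fst q) \<omega> * \<epsilon> (snd q) \<omega>"
  have 1: "integrable M (\<lambda>\<omega>. ?f q \<omega> * ?f q' \<omega>)" if "q \<in> P" "q' \<in> P" for q q'
    using assms(2)[of "fst q" "snd q"] assms(2)[of "fst q'" "snd q'"] that
    by (intro noise_pair_moment(1)) auto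
  have 2: "expectation (\<lambda>\<omega>. ?f q \<omega> * ?f q' \<omega>) = (if q = q' then \<sigma> ^ 4 else 0)"
    if "q \<in> P" "q' \<in> P" for q q'
    using assms(2)[of "fst q" "snd q"] assms(2)[of "fst q'" "snd q'"] that
    by (subst noise_pair_moment(2)) auto
  note O = orthogonal_sum_square[OF assms(1), of ?f, OF 1 2, of "\<lambda>q. c (fst q) (snd q)"]
  show "integrable M (\<lambda>\<omega>. (\<Sum>(j, k)\<in>P. c j k * (\<epsilon> j \<omega> * \<epsilon> k \<omega>))\<^sup>2)"
    using O(1) by (simp add: case_prod_beta)
  show "expectation (\<lambda>\<omega>. (\<Sum>(j, k)\<in>P. c j k * (\<epsilon> j \<omega> * \<epsilon> k \<omega>))\<^sup>2)
      = \<sigma> ^ 4 * (\<Sum>(j, k)\<in>P. (c j k)\<^sup>2)"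
    using O(2) by (simp add: case_prod_beta)
qed

text \<open>Applied both to the noise itself and to its centred truncated square, hence the general
  \<open>f\<close>.\<close>

lemma noise_function_sum_square:
  fixes f :: "real \<Rightarrow> real"
  assumes I: "finite I" "I \<subseteq> {1..}" and f [measurable]: "f \<in> borel_measurable borel"
    and int: "integrable M (\<lambda>\<omega>. f (\<epsilon> 1 \<omega>))" and mean: "expectation (\<lambda>\<omega>. f (\<epsilon> 1 \<omega>)) = 0"
    and sq: "integrable M (\<lambda>\<omega>. (f (\<epsilon> 1 \<omega>))\<^sup>2)"
  shows "integrable M (\<lambda>\<omega>. (\<Sum>k\<in>I. c k * f (\<epsilon> k \<omega>))\<^sup>2)"
    and "expectation (\<lambda>\<omega>. (\<Sum>k\<in>I. c k * f (\<epsilon> k \<omega>))\<^sup>2)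
      = expectation (\<lambda>\<omega>. (f (\<epsilon> 1 \<omega>))\<^sup>2) * (\<Sum>k\<in>I. (c k)\<^sup>2)"
proof -
  have *: "integrable M (\<lambda>\<omega>. f (\<epsilon> i \<omega>) * f (\<epsilon> j \<omega>)) \<and>
    expectation (\<lambda>\<omega>. f (\<epsilon> i \<omega>) * f (\<epsilon> j \<omega>)) = (if i = j then expectation (\<lambda>\<omega>. (f (\<epsilon> 1 \<omega>))\<^sup>2) else 0)"
    if ij: "i \<in> I" "j \<in> I" for i j
  proof (cases "i = j")
    case True
    then show ?thesis using noise_ident_integral[of i "\<lambda>x. (f x)\<^sup>2"] sq I ij
      by (auto simp: power2_eq_square)
  next
    case False
    have "finite {i, j}" "{i, j} \<subseteq> {1..}" using I ij by auto
    from noise_prod_expectation[OF this, of "\<lambda>_. f", OF f int] False mean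
    show ?thesis by simp
  qed
  note O = orthogonal_sum_square[OF I(1), of "\<lambda>k \<omega>. f (\<epsilon> k \<omega>)", OF conjunct1[OF *] conjunct2[OF *]]
  show "integrable M (\<lambda>\<omega>. (\<Sum>k\<in>I. c k * f (\<epsilon> k \<omega>))\<^sup>2)" by (rule O(1))
  show "expectation (\<lambda>\<omega>. (\<Sum>k\<in>I. c k * f (\<epsilon> k \<omega>))\<^sup>2)
      = expectation (\<lambda>\<omega>. (f (\<epsilon> 1 \<omega>))\<^sup>2) * (\<Sum>k\<in>I. (c k)\<^sup>2)" by (rule O(2))
qed

section \<open>Truncated squares of the noise\<close>

text \<open>The truncated square is bounded, so its sums have a variance of order \<open>n\<close>
  even when the noise has no fourth moment.\<close>

definition trunc_mean :: real where
  "trunc_mean = expectation (\<lambda>\<omega>. min ((\<epsilon> 1 \<omega>)\<^sup>2) 1)"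

lemma trunc_integrable: "integrable M (\<lambda>\<omega>. min ((\<epsilon> 1 \<omega>)\<^sup>2) 1)"
  using noise_measurable[of 1] by (intro integrable_const_bound[where B = 1]) auto

text \<open>If the truncated square had mean zero, the noise would vanish almost surely, against
  \<open>\<sigma> > 0\<close>.\<close>

lemma trunc_mean_pos: "trunc_mean > 0"
proof (rule ccontr)
  assume "\<not> trunc_mean > 0"
  moreover have "trunc_mean \<ge> 0" unfolding trunc_mean_def by (rule integral_nonneg_AE) auto
  ultimately have "trunc_mean = 0" by linarith
  then have "expectation (\<lambda>\<omega>. min ((\<epsilon> 1 \<omega>)\<^sup>2) 1) = 0"
    unfolding trunc_mean_def .
  then have "AE \<omega> in M. min ((\<epsilon> 1 \<omega>)\<^sup>2) 1 = 0"
    using integral_nonneg_eq_0_iff_AE[OF trunc_integrable] by auto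
  then have "AE \<omega> in M. (\<epsilon> 1 \<omega>)\<^sup>2 = 0" by eventually_elim (auto simp: min_def split: if_splits)
  then have "expectation (\<lambda>\<omega>. (\<epsilon> 1 \<omega>)\<^sup>2) = 0" by (rule integral_eq_zero_AE)
  then show False using noise_second_moment sigma_pos by simp
qed

lemma trunc_mean_le_1: "trunc_mean \<le> 1"
proof -
  have "trunc_mean \<le> expectation (\<lambda>_. 1)"
    unfolding trunc_mean_def by (intro integral_mono trunc_integrable) auto
  then show ?thesis by (simp add: prob_space)
qed

lemma trunc_sum_square:
  assumes I: "finite I" "I \<subseteq> {1..}"
  shows "integrable M (\<lambda>\<omega>. (\<Sum>k\<in>I. min ((\<epsilon> k \<omega>)\<^sup>2) 1 - trunc_mean)\<^sup>2)"
    and "expectation (\<lambda>\<omega>. (\<Sum>k\<in>I. min ((\<epsilon> k \<omega>)\<^sup>2) 1 - trunc_mean)\<^sup>2) \<le> card I"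
proof -
  let ?f = "\<lambda>x::real. min (x\<^sup>2) 1 - trunc_mean"
  have [measurable]: "\<epsilon> 1 \<in> borel_measurable M" by simp
  have b: "\<bar>?f x\<bar> \<le> 1" for x
  proof -
    have "0 \<le> min (x\<^sup>2) 1" "min (x\<^sup>2) 1 \<le> 1" by auto
    then show ?thesis using trunc_mean_le_1 trunc_mean_pos by linarith
  qed
  have b2: "(?f x)\<^sup>2 \<le> 1" for x using b[of x] by (simp add: abs_square_le_1)
  have int: "integrable M (\<lambda>\<omega>. ?f (\<epsilon> 1 \<omega>))"
    using trunc_integrable by simp
  have sq: "integrable M (\<lambda>\<omega>. (?f (\<epsilon> 1 \<omega>))\<^sup>2)"
    using b2 by (intro integrable_const_bound[where B = 1]) auto
  have mean: "expectation (\<lambda>\<omega>. ?f (\<epsilon> 1 \<omega>)) = 0"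
    using trunc_integrable by (simp add: prob_space trunc_mean_def)
  have f: "?f \<in> borel_measurable borel" by measurable
  note S = noise_function_sum_square[OF I f int mean sq, of "\<lambda>_. 1"]
  show "integrable M (\<lambda>\<omega>. (\<Sum>k\<in>I. min ((\<epsilon> k \<omega>)\<^sup>2) 1 - trunc_mean)\<^sup>2)" using S(1) by simp
  have "expectation (\<lambda>\<omega>. (?f (\<epsilon> 1 \<omega>))\<^sup>2) \<le> expectation (\<lambda>_. 1)"
    using b2 sq by (intro integral_mono) auto
  then have "expectation (\<lambda>\<omega>. (?f (\<epsilon> 1 \<omega>))\<^sup>2) \<le> 1" by (simp add: prob_space)
  from mult_right_mono[OF this, of "real (card I)"]
  show "expectation (\<lambda>\<omega>. (\<Sum>k\<in>I. min ((\<epsilon> k \<omega>)\<^sup>2) 1 - trunc_mean)\<^sup>2) \<le> card I"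
    using S(2) by simp
qed

lemma noise_sum_square:
  assumes I: "finite I" "I \<subseteq> {1..}"
  shows "integrable M (\<lambda>\<omega>. (\<Sum>k\<in>I. c k * \<epsilon> k \<omega>)\<^sup>2)"
    and "expectation (\<lambda>\<omega>. (\<Sum>k\<in>I. c k * \<epsilon> k \<omega>)\<^sup>2) = \<sigma>\<^sup>2 * (\<Sum>k\<in>I. (c k)\<^sup>2)"
proof -
  note S = noise_function_sum_square[OF I _ noise_integrable noise_mean noise_square_integrable, of c]
  show "integrable M (\<lambda>\<omega>. (\<Sum>k\<in>I. c k * \<epsilon> k \<omega>)\<^sup>2)" by (rule S(1)) simp
  show "expectation (\<lambda>\<omega>. (\<Sum>k\<in>I. c k * \<epsilon> k \<omega>)\<^sup>2) = \<sigma>\<^sup>2 * (\<Sum>k\<in>I. (c k)\<^sup>2)"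
    unfolding noise_second_moment[symmetric] by (rule S(2)) simp
qed

section \<open>Expectations of the terms in the error bound\<close>

lemma driven_energy:
  fixes a :: "nat \<Rightarrow> real" and n :: nat
  defines "W \<equiv> \<lambda>\<omega>. \<Sum>i<p. \<Sum>k<n. (driven p a n (\<lambda>k. \<epsilon> k \<omega>) (int k - int i))\<^sup>2"
  shows "integrable M W"
    and "expectation W \<le> real p * real n * \<sigma>\<^sup>2 * (\<Sum>j<n. (impulse p a (int j))\<^sup>2)"
proof -
  have one: "integrable M (\<lambda>\<omega>. (driven p a n (\<lambda>k. \<epsilon> k \<omega>) z)\<^sup>2)"
    "expectation (\<lambda>\<omega>. (driven p a n (\<lambda>k. \<epsilon> k \<omega>) z)\<^sup>2) = \<sigma>\<^sup>2 * (\<Sum>l=1..n. (impulse p a (z - int l))\<^sup>2)" for z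
    unfolding driven_def by (rule noise_sum_square; simp)+
  show "integrable M W" unfolding W_def by (intro Bochner_Integration.integrable_sum one)
  have "expectation W = (\<Sum>i<p. \<Sum>k<n. expectation (\<lambda>\<omega>. (driven p a n (\<lambda>k. \<epsilon> k \<omega>) (int k - int i))\<^sup>2))"
    unfolding W_def by (simp add: Bochner_Integration.integral_sum one(1))
  also have "\<dots> \<le> (\<Sum>i<p. \<Sum>k<n. \<sigma>\<^sup>2 * (\<Sum>j<n. (impulse p a (int j))\<^sup>2))"
    unfolding one(2) by (intro sum_mono mult_left_mono impulse_shift_sum) auto
  finally show "expectation W \<le> real p * real n * \<sigma>\<^sup>2 * (\<Sum>j<n. (impulse p a (int j))\<^sup>2)"
    by (simp add: mult_ac)
qed

text \<open>The driven value at time \<open>k\<close> uses noise up to \<open>k\<close> only and is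
  multiplied by the noise at \<open>Suc k\<close>. The score is therefore a combination of products
  over strictly ordered pairs, which are orthogonal.\<close>

lemma driven_score:
  fixes a :: "nat \<Rightarrow> real" and n :: nat
  defines "W \<equiv> \<lambda>\<omega>. \<Sum>i<p. (\<Sum>k<n. \<epsilon> (Suc k) \<omega> * driven p a n (\<lambda>k. \<epsilon> k \<omega>) (int k - int i))\<^sup>2"
  shows "integrable M W"
    and "expectation W \<le> real p * real n * \<sigma> ^ 4 * (\<Sum>j<n. (impulse p a (int j))\<^sup>2)"
proof -
  define P where "P = {(l, m) \<in> {1..n} \<times> {1..n}. l < m}"
  define c where "c i l m = impulse p a (int m - 1 - int i - int l)" for i l m :: nat
  have fin: "finite P" unfolding P_def by (rule finite_subset[of _ "{1..n} \<times> {1..n}"]) auto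
  have P: "1 \<le> l \<and> l < m" if "(l, m) \<in> P" for l m using that by (auto simp: P_def)
  have eq: "(\<Sum>k<n. \<epsilon> (Suc k) \<omega> * driven p a n (\<lambda>k. \<epsilon> k \<omega>) (int k - int i))
      = (\<Sum>(l, m)\<in>P. c i l m * (\<epsilon> l \<omega> * \<epsilon> m \<omega>))" for i \<omega>
  proof -
    have "(\<Sum>k<n. \<epsilon> (Suc k) \<omega> * driven p a n (\<lambda>k. \<epsilon> k \<omega>) (int k - int i))
        = (\<Sum>k<n. \<Sum>l=1..n. c i l (Suc k) * (\<epsilon> l \<omega> * \<epsilon> (Suc k) \<omega>))"
      by (simp add: driven_def c_def sum_distrib_left mult_ac)
    also have "\<dots> = (\<Sum>m=1..n. \<Sum>l=1..n. c i l m * (\<epsilon> l \<omega> * \<epsilon> m \<omega>))"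
      by (simp add: sum.atLeast1_atMost_eq)
    also have "\<dots> = (\<Sum>(l, m)\<in>{1..n} \<times> {1..n}. c i l m * (\<epsilon> l \<omega> * \<epsilon> m \<omega>))"
      by (subst sum.swap) (rule sum.cartesian_product)
    also have "\<dots> = (\<Sum>(l, m)\<in>P. c i l m * (\<epsilon> l \<omega> * \<epsilon> m \<omega>))"
      by (rule sum.mono_neutral_right) (auto simp: P_def c_def dest!: impulse_nonzero)
    finally show ?thesis .
  qed
  note one = noise_pair_sum_square[OF fin P, of "c i" for i]
  show "integrable M W"
    unfolding W_def eq by (intro Bochner_Integration.integrable_sum one)
  have csum: "(\<Sum>(l, m)\<in>P. (c i l m)\<^sup>2) \<le> real n * (\<Sum>j<n. (impulse p a (int j))\<^sup>2)" for i
  proof -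
    have "(\<Sum>(l, m)\<in>P. (c i l m)\<^sup>2) \<le> (\<Sum>(l, m)\<in>{1..n} \<times> {1..n}. (c i l m)\<^sup>2)"
      by (rule sum_mono2) (auto simp: P_def)
    also have "\<dots> = (\<Sum>m=1..n. \<Sum>l=1..n. (c i l m)\<^sup>2)"
      by (subst sum.swap) (rule sum.cartesian_product[symmetric])
    also have "\<dots> \<le> (\<Sum>m=1..n. (\<Sum>j<n. (impulse p a (int j))\<^sup>2))"
      unfolding c_def by (intro sum_mono impulse_shift_sum) auto
    finally show ?thesis by simp
  qed
  have "expectation W = (\<Sum>i<p. \<sigma> ^ 4 * (\<Sum>(l, m)\<in>P. (c i l m)\<^sup>2))"
    unfolding W_def eq by (subst Bochner_Integration.integral_sum) (use one in auto)
  also have "\<dots> \<le> (\<Sum>i<p. \<sigma> ^ 4 * (real n * (\<Sum>j<n. (impulse p a (int j))\<^sup>2)))"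
    by (intro sum_mono mult_left_mono csum) auto
  finally show "expectation W \<le> real p * real n * \<sigma> ^ 4 * (\<Sum>j<n. (impulse p a (int j))\<^sup>2)"
    by (simp add: mult_ac)
qed

lemma noise_projection:
  fixes f :: "nat \<Rightarrow> nat \<Rightarrow> real" and d n :: nat
  assumes f: "\<And>l. l < d \<Longrightarrow> (\<Sum>k<n. (f l k)\<^sup>2) = 1"
  defines "W \<equiv> \<lambda>\<omega>. \<Sum>l<d. (\<Sum>k<n. f l k * \<epsilon> (Suc k) \<omega>)\<^sup>2"
  shows "integrable M W" and "expectation W = \<sigma>\<^sup>2 * real d"
proof -
  have eq: "(\<Sum>k<n. f l k * \<epsilon> (Suc k) \<omega>) = (\<Sum>m=1..n. f l (m - 1) * \<epsilon> m \<omega>)" for l \<omega>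
    by (simp add: sum.atLeast1_atMost_eq)
  have one: "integrable M (\<lambda>\<omega>. (\<Sum>k<n. f l k * \<epsilon> (Suc k) \<omega>)\<^sup>2)" for l
    unfolding eq by (rule noise_sum_square) auto
  have two: "expectation (\<lambda>\<omega>. (\<Sum>k<n. f l k * \<epsilon> (Suc k) \<omega>)\<^sup>2) = \<sigma>\<^sup>2" if "l < d" for l
  proof -
    have "(\<Sum>m=1..n. (f l (m - 1))\<^sup>2) = 1" using f[OF that] by (simp add: sum.atLeast1_atMost_eq)
    then show ?thesis unfolding eq by (subst noise_sum_square) auto
  qed
  show "integrable M W" unfolding W_def by (intro Bochner_Integration.integrable_sum one)
  show "expectation W = \<sigma>\<^sup>2 * real d"
    unfolding W_def by (simp add: Bochner_Integration.integral_sum one two)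
qed

text \<open>Every squared sum has orthogonal summands and so an expectation of order
  \<open>n\<close>, which is negligible against the threshold of order \<open>n ^ 2\<close> used on
  paths.\<close>

lemma noise_gram_dev_expectation:
  fixes n :: nat
  defines "W \<equiv> \<lambda>\<omega>. noise_gram_dev p trunc_mean (\<lambda>k. \<epsilon> k \<omega>) n"
  shows "integrable M W" and "expectation W \<le> (real p + (real p)\<^sup>2 * \<sigma> ^ 4) * real n"
proof -
  have T: "integrable M (\<lambda>\<omega>. (\<Sum>k=p..<n. min ((\<epsilon> (k - i) \<omega>)\<^sup>2) 1 - trunc_mean)\<^sup>2) \<and>
    expectation (\<lambda>\<omega>. (\<Sum>k=p..<n. min ((\<epsilon> (k - i) \<omega>)\<^sup>2) 1 - trunc_mean)\<^sup>2) \<le> real n" if "i < p" for i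
  proof -
    define I where "I = (\<lambda>k. k - i) ` {p..<n}"
    have inj: "inj_on (\<lambda>k. k - i) {p..<n}" using that by (auto simp: inj_on_def)
    have I: "finite I" "I \<subseteq> {1..}" using that by (auto simp: I_def)
    have "card I \<le> n" using card_image[OF inj] by (simp add: I_def)
    moreover have "(\<Sum>k=p..<n. min ((\<epsilon> (k - i) \<omega>)\<^sup>2) 1 - trunc_mean)
        = (\<Sum>k\<in>I. min ((\<epsilon> k \<omega>)\<^sup>2) 1 - trunc_mean)" for \<omega>
      by (simp add: I_def sum.reindex[OF inj])
    ultimately show ?thesis using trunc_sum_square[OF I] by auto
  qed
  have C: "integrable M (\<lambda>\<omega>. (\<Sum>k=p..<n. \<epsilon> (k - i) \<omega> * \<epsilon> (k - j) \<omega>)\<^sup>2) \<and>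
    expectation (\<lambda>\<omega>. (\<Sum>k=p..<n. \<epsilon> (k - i) \<omega> * \<epsilon> (k - j) \<omega>)\<^sup>2) \<le> \<sigma> ^ 4 * real n"
    if ij: "i < p" "j < p" "i \<noteq> j" for i j
  proof -
    \<comment> \<open>The pair of noise times in increasing order, strictly so because
      \<open>i \<noteq> j\<close>; this is the form in which products are orthogonal.\<close>
    define F where "F k = (k - max i j, k - min i j)" for k :: nat
    have inj: "inj_on F {p..<n}" using ij by (auto simp: inj_on_def F_def max_def min_def split: if_splits)
    have fin: "finite (F ` {p..<n})" by simp
    have P: "1 \<le> l \<and> l < m" if "(l, m) \<in> F ` {p..<n}" for l m
      using that ij by (auto simp: F_def max_def min_def split: if_splits)
    have eq: "(\<Sum>k=p..<n. \<epsilon> (k - i) \<omega> * \<epsilon> (k - j) \<omega>)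
        = (\<Sum>(l, m)\<in>F ` {p..<n}. 1 * (\<epsilon> l \<omega> * \<epsilon> m \<omega>))" for \<omega>
      by (subst sum.reindex[OF inj]) (simp add: F_def max_def min_def mult.commute)
    have "(\<Sum>(l, m)\<in>F ` {p..<n}. (1::real)\<^sup>2) = real (n - p)"
      using card_image[OF inj] by simp
    then have "\<sigma> ^ 4 * (\<Sum>(l, m)\<in>F ` {p..<n}. (1::real)\<^sup>2) \<le> \<sigma> ^ 4 * real n"
      by (intro mult_left_mono) auto
    then show ?thesis
      unfolding eq using noise_pair_sum_square[OF fin P, of "\<lambda>_ _. 1"] by simp
  qed
  show "integrable M W"
    unfolding W_def noise_gram_dev_def
    by (intro Bochner_Integration.integrable_add Bochner_Integration.integrable_sum) (use T C in auto)
  have "expectation W = (\<Sum>i<p. expectation (\<lambda>\<omega>. (\<Sum>k=p..<n. min ((\<epsilon> (k - i) \<omega>)\<^sup>2) 1 - trunc_mean)\<^sup>2))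
      + (\<Sum>i<p. \<Sum>j\<in>{..<p} - {i}. expectation (\<lambda>\<omega>. (\<Sum>k=p..<n. \<epsilon> (k - i) \<omega> * \<epsilon> (k - j) \<omega>)\<^sup>2))"
  proof -
    have 1: "expectation (\<lambda>\<omega>. \<Sum>j\<in>{..<p} - {i}. (\<Sum>k=p..<n. \<epsilon> (k - i) \<omega> * \<epsilon> (k - j) \<omega>)\<^sup>2)
      = (\<Sum>j\<in>{..<p} - {i}. expectation (\<lambda>\<omega>. (\<Sum>k=p..<n. \<epsilon> (k - i) \<omega> * \<epsilon> (k - j) \<omega>)\<^sup>2))" if "i < p" for i
      using C that by (intro Bochner_Integration.integral_sum) auto
    have 2: "integrable M (\<lambda>\<omega>. \<Sum>j\<in>{..<p} - {i}. (\<Sum>k=p..<n. \<epsilon> (k - i) \<omega> * \<epsilon> (k - j) \<omega>)\<^sup>2)" if "i < p" for i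
      using C that by (intro Bochner_Integration.integrable_sum) auto
    have 3: "expectation (\<lambda>\<omega>. \<Sum>i<p. \<Sum>j\<in>{..<p} - {i}. (\<Sum>k=p..<n. \<epsilon> (k - i) \<omega> * \<epsilon> (k - j) \<omega>)\<^sup>2)
      = (\<Sum>i<p. \<Sum>j\<in>{..<p} - {i}. expectation (\<lambda>\<omega>. (\<Sum>k=p..<n. \<epsilon> (k - i) \<omega> * \<epsilon> (k - j) \<omega>)\<^sup>2))"
      by (subst Bochner_Integration.integral_sum) (auto intro!: 2 sum.cong 1)
    have 4: "expectation (\<lambda>\<omega>. \<Sum>i<p. (\<Sum>k=p..<n. min ((\<epsilon> (k - i) \<omega>)\<^sup>2) 1 - trunc_mean)\<^sup>2)
      = (\<Sum>i<p. expectation (\<lambda>\<omega>. (\<Sum>k=p..<n. min ((\<epsilon> (k - i) \<omega>)\<^sup>2) 1 - trunc_mean)\<^sup>2))"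
      using T by (intro Bochner_Integration.integral_sum) auto
    show ?thesis
      unfolding W_def noise_gram_dev_def 3[symmetric] 4[symmetric]
      by (intro Bochner_Integration.integral_add Bochner_Integration.integrable_sum) (use T C 2 in auto)
  qed
  also have "\<dots> \<le> (\<Sum>i<p. real n) + (\<Sum>i<p. \<Sum>j\<in>{..<p} - {i}. \<sigma> ^ 4 * real n)"
    using T C by (intro add_mono sum_mono) auto
  also have "\<dots> \<le> (\<Sum>i<p. real n) + (\<Sum>i<p. \<Sum>j<p. \<sigma> ^ 4 * real n)"
    by (intro add_left_mono sum_mono sum_mono2) auto
  finally show "expectation W \<le> (real p + (real p)\<^sup>2 * \<sigma> ^ 4) * real n"
    by (simp add: power2_eq_square algebra_simps)
qed

section \<open>Domination of the error and consistency\<close>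

lemma ar_recursion:
  assumes "n \<ge> 1" "1 \<le> k" "k \<le> n" "\<omega> \<in> space M"
  shows "X n (int k) \<omega> = (\<Sum>j<p. \<theta> n $ j * X n (int k - 1 - int j) \<omega>) + \<epsilon> k \<omega>"
proof -
  have "(\<Sum>i=1..p. \<theta> n $ (i - 1) * X n (int k - int i) \<omega>) = (\<Sum>j<p. \<theta> n $ j * X n (int k - 1 - int j) \<omega>)"
    by (simp add: sum.atLeast1_atMost_eq algebra_simps)
  with ar_equation[OF assms] show ?thesis by simp
qed

text \<open>\<open>D\<close> adds up the non-negative quantities of
  \<open>ols_error_pathwise\<close>, so \<open>D \<omega> \<le> \<eta>\<close> bounds each of them.
  The choice of \<open>t\<close> makes the expectations of \<open>t * q\<close> and of the driven
  energy over \<open>n ^ 2 * t\<close> both of order \<open>t\<close>.\<close>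

lemma ols_error_dominated:
  fixes n :: nat and S :: real
  assumes n: "1 \<le> n" "4 * p \<le> n" and S: "(\<Sum>j<p. (\<theta> n $ j)\<^sup>2) \<le> S"
  defines "t \<equiv> sqrt ((\<Sum>j<n. (impulse p (\<lambda>j. \<theta> n $ j) (int j))\<^sup>2) / real n)"
    and "\<kappa> \<equiv> trunc_mean / (4 * (1 + S) * (1 + real p))"
  obtains D where "integrable M D" "\<And>\<omega>. 0 \<le> D \<omega>"
    "expectation D \<le> real p * \<sigma> ^ 4 * t\<^sup>2 + ((real p)\<^sup>2 * \<sigma>\<^sup>2 + real p * \<sigma>\<^sup>2) * t
       + ((real p)\<^sup>2 * \<sigma>\<^sup>2 + real p + (real p)\<^sup>2 * \<sigma> ^ 4) / real n"
    "\<And>\<omega> \<eta>. \<omega> \<in> space M \<Longrightarrow> D \<omega> \<le> \<eta> \<Longrightarrow> sqrt \<eta> \<le> trunc_mean / (4 * (1 + real p)) \<Longrightarrow>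
       eucl_norm (ols_estimator p (\<lambda>k. X n k \<omega>) n - \<theta> n) \<le> (sqrt \<eta> + \<eta>) / \<kappa> + sqrt \<eta> / sqrt \<kappa>"
proof -
  define a where "a = (\<lambda>j. \<theta> n $ j)"
  define H where "H = (\<Sum>j<n. (impulse p a (int j))\<^sup>2)"
  have n0: "real n > 0" using n by simp
  \<comment> \<open>The first coefficient keeps the square sum positive, so that division by
    \<open>t\<close> is meaningful.\<close>
  have "impulse p a 0 = 1" by (simp add: impulse_def)
  then have "(\<Sum>j<n. (impulse p a (int j))\<^sup>2) > 0"
    using n by (intro sum_pos2[of _ 0]) auto
  then have H0: "H > 0" by (simp add: H_def)
  have t: "t = sqrt (H / real n)" by (simp add: t_def H_def a_def)
  have t0: "t > 0" using H0 n0 by (simp add: t)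
  have t2: "t\<^sup>2 = H / real n" using H0 n0 by (simp add: t)
  \<comment> \<open>The basis depends on \<open>n\<close> and the coefficients but not on the path,
    so \<open>q\<close> below has a computable expectation, while the inequality holds for every
    realisation of the noise.\<close>
  obtain d :: nat and f where d: "d \<le> card ({..<p} \<times> {..<p})"
    and f: "\<And>l. l < d \<Longrightarrow> (\<Sum>k<n. (f l k)\<^sup>2) = 1"
    and proj: "\<And>c e. (\<Sum>k<n. e k * (\<Sum>s\<in>{..<p} \<times> {..<p}. c s * ar_propagator p a k (fst s) (snd s)))\<^sup>2
      \<le> (\<Sum>l<d. (\<Sum>k<n. f l k * e k)\<^sup>2)
        * (\<Sum>k<n. (\<Sum>s\<in>{..<p} \<times> {..<p}. c s * ar_propagator p a k (fst s) (snd s))\<^sup>2)"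
    by (rule span_projection_bound[of "{..<p} \<times> {..<p}" "{..<n}"
          "\<lambda>s k. ar_propagator p a k (fst s) (snd s)"]) auto
  define q where "q = (\<lambda>\<omega>. \<Sum>l<d. (\<Sum>k<n. f l k * \<epsilon> (Suc k) \<omega>)\<^sup>2)"
  define Z where "Z = (\<lambda>\<omega>. \<Sum>i<p. (\<Sum>k<n. \<epsilon> (Suc k) \<omega> * driven p a n (\<lambda>k. \<epsilon> k \<omega>) (int k - int i))\<^sup>2)"
  define W where "W = (\<lambda>\<omega>. \<Sum>i<p. \<Sum>k<n. (driven p a n (\<lambda>k. \<epsilon> k \<omega>) (int k - int i))\<^sup>2)"
  define F where "F = (\<lambda>\<omega>. noise_gram_dev p trunc_mean (\<lambda>k. \<epsilon> k \<omega>) n)"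
  have nonneg: "0 \<le> q \<omega>" "0 \<le> Z \<omega>" "0 \<le> W \<omega>" "0 \<le> F \<omega>" for \<omega>
    by (auto simp: q_def Z_def W_def F_def noise_gram_dev_def intro!: sum_nonneg add_nonneg_nonneg)
  define D where "D = (\<lambda>\<omega>. Z \<omega> / (real n)\<^sup>2 + q \<omega> / real n + (t * q \<omega> + W \<omega> / ((real n)\<^sup>2 * t)) + F \<omega> / (real n)\<^sup>2)"
  have q: "integrable M q" "expectation q = \<sigma>\<^sup>2 * real d"
    unfolding q_def using noise_projection[where d = d and n = n and f = f] f by auto
  have Z: "integrable M Z" "expectation Z \<le> real p * real n * \<sigma> ^ 4 * H"
    unfolding Z_def H_def by (rule driven_score)+
  have W: "integrable M W" "expectation W \<le> real p * real n * \<sigma>\<^sup>2 * H"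
    unfolding W_def H_def by (rule driven_energy)+
  have F: "integrable M F" "expectation F \<le> (real p + (real p)\<^sup>2 * \<sigma> ^ 4) * real n"
    unfolding F_def by (rule noise_gram_dev_expectation)+
  show ?thesis
  proof (rule that[of D])
    show "integrable M D" unfolding D_def using q Z W F by simp
    show D0: "0 \<le> D \<omega>" for \<omega>
      unfolding D_def using nonneg[of \<omega>] t0 by simp
    have "expectation D = expectation Z / (real n)\<^sup>2 + expectation q / real n
        + (t * expectation q + expectation W / ((real n)\<^sup>2 * t)) + expectation F / (real n)\<^sup>2"
      unfolding D_def using q(1) Z(1) W(1) F(1) by simp
    also have "\<dots> \<le> real p * real n * \<sigma> ^ 4 * H / (real n)\<^sup>2 + \<sigma>\<^sup>2 * (real p)\<^sup>2 / real n
        + (t * (\<sigma>\<^sup>2 * (real p)\<^sup>2) + real p * real n * \<sigma>\<^sup>2 * H / ((real n)\<^sup>2 * t))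
        + (real p + (real p)\<^sup>2 * \<sigma> ^ 4) * real n / (real n)\<^sup>2"
    proof -
      have "real d \<le> (real p)\<^sup>2" using d by (simp add: power2_eq_square flip: of_nat_mult)
      then have "expectation q \<le> \<sigma>\<^sup>2 * (real p)\<^sup>2" unfolding q(2) by (rule mult_left_mono) simp
      then show ?thesis using Z(2) W(2) F(2) t0 by (intro add_mono divide_right_mono mult_left_mono) auto
    qed
    also have "\<dots> = real p * \<sigma> ^ 4 * (H / real n) + \<sigma>\<^sup>2 * (real p)\<^sup>2 / real n
        + (t * (\<sigma>\<^sup>2 * (real p)\<^sup>2) + real p * \<sigma>\<^sup>2 * (H / real n) / t)
        + (real p + (real p)\<^sup>2 * \<sigma> ^ 4) / real n"
      using n0 by (simp add: power2_eq_square)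
    also have "\<dots> = real p * \<sigma> ^ 4 * t\<^sup>2 + \<sigma>\<^sup>2 * (real p)\<^sup>2 / real n
        + (t * (\<sigma>\<^sup>2 * (real p)\<^sup>2) + real p * \<sigma>\<^sup>2 * t) + (real p + (real p)\<^sup>2 * \<sigma> ^ 4) / real n"
      unfolding t2[symmetric] using t0 by (simp add: power2_eq_square)
    finally show "expectation D \<le> real p * \<sigma> ^ 4 * t\<^sup>2 + ((real p)\<^sup>2 * \<sigma>\<^sup>2 + real p * \<sigma>\<^sup>2) * t
       + ((real p)\<^sup>2 * \<sigma>\<^sup>2 + real p + (real p)\<^sup>2 * \<sigma> ^ 4) / real n"
      by (simp add: algebra_simps add_divide_distrib)
  next
    fix \<omega> \<eta> assume w: "\<omega> \<in> space M" and De: "D \<omega> \<le> \<eta>"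
      and small: "sqrt \<eta> \<le> trunc_mean / (4 * (1 + real p))"
    have parts: "0 \<le> Z \<omega> / (real n)\<^sup>2" "0 \<le> q \<omega> / real n" "0 \<le> t * q \<omega> + W \<omega> / ((real n)\<^sup>2 * t)"
      "0 \<le> F \<omega> / (real n)\<^sup>2"
      using nonneg[of \<omega>] t0 by auto
    have "Z \<omega> / (real n)\<^sup>2 \<le> \<eta>" "q \<omega> / real n \<le> \<eta>" "F \<omega> / (real n)\<^sup>2 \<le> \<eta>"
      and e: "t * q \<omega> + W \<omega> / ((real n)\<^sup>2 * t) \<le> \<eta>"
      using De parts unfolding D_def by linarith+
    then have bounds: "Z \<omega> \<le> \<eta> * (real n)\<^sup>2" "q \<omega> \<le> \<eta> * real n" "F \<omega> \<le> \<eta> * (real n)\<^sup>2"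
      using n0 by (simp_all add: pos_divide_le_eq)
    have eta: "0 \<le> \<eta>" using parts(3) e by linarith
    show "eucl_norm (ols_estimator p (\<lambda>k. X n k \<omega>) n - \<theta> n) \<le> (sqrt \<eta> + \<eta>) / \<kappa> + sqrt \<eta> / sqrt \<kappa>"
    proof (rule ols_error_pathwise[where m = trunc_mean and e = "\<lambda>k. \<epsilon> k \<omega>" and q = "q \<omega>" and t = t and S = S])
      show "\<theta> n \<in> carrier_vec p" using theta_carrier n by blast
      show "X n (int k) \<omega> = (\<Sum>j<p. \<theta> n $ j * X n (int k - 1 - int j) \<omega>) + \<epsilon> k \<omega>"
        if "1 \<le> k" "k \<le> n" for k using ar_recursion n(1) that w by blast
      show "(\<Sum>k<n. \<epsilon> (Suc k) \<omega> * (\<Sum>s\<in>{..<p} \<times> {..<p}. c s * ar_propagator p (\<lambda>j. \<theta> n $ j) k (fst s) (snd s)))\<^sup>2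
        \<le> q \<omega> * (\<Sum>k<n. (\<Sum>s\<in>{..<p} \<times> {..<p}. c s * ar_propagator p (\<lambda>j. \<theta> n $ j) k (fst s) (snd s))\<^sup>2)" for c
        using proj[of "\<lambda>k. \<epsilon> (Suc k) \<omega>" c] unfolding q_def a_def .
    qed (fact n S trunc_mean_pos t0 nonneg(1) eta small \<kappa>_def[THEN meta_eq_to_obj_eq]
        bounds[unfolded Z_def F_def a_def] e[unfolded W_def a_def])+
  qed
qed

text \<open>Markov's inequality for \<open>D\<close> at a fixed level \<open>\<eta>\<close>: its
  expectation tends to zero because \<open>t n\<close> does. The roots of the polynomials matter
  only through the assumed decay of the averaged impulse energy.\<close>

lemma ols_consistent:
  assumes H: "(\<lambda>n. (\<Sum>j<n. (impulse p (\<lambda>j. \<theta> n $ j) (int j))\<^sup>2) / real n) \<longlonglongrightarrow> 0"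
    and S: "eventually (\<lambda>n. (\<Sum>j<p. (\<theta> n $ j)\<^sup>2) \<le> S) sequentially"
  shows "tendsto_in_prob M (\<lambda>n \<omega>. eucl_norm (ols_estimator p (\<lambda>k. X n k \<omega>) n - \<theta> n)) 0"
  unfolding tendsto_in_prob_def
proof (intro allI impI)
  fix \<delta> :: real assume \<delta>: "\<delta> > 0"
  define \<kappa> where "\<kappa> = trunc_mean / (4 * (1 + S) * (1 + real p))"
  have "eventually (\<lambda>n::nat. 0 \<le> S) sequentially"
    using S by eventually_elim (meson order_trans sum_nonneg zero_le_power2)
  then have S0: "0 \<le> S" by simp
  have kap: "\<kappa> > 0" using trunc_mean_pos S0 by (simp add: \<kappa>_def)
  \<comment> \<open>The pathwise bound is continuous in \<open>\<eta>\<close> and vanishes at zero,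
    so some positive \<open>\<eta>\<close> brings it below \<open>\<delta>\<close>.\<close>
  have lim: "((\<lambda>\<eta>. (sqrt \<eta> + \<eta>) / \<kappa> + sqrt \<eta> / sqrt \<kappa>) \<longlongrightarrow> (sqrt 0 + 0) / \<kappa> + sqrt 0 / sqrt \<kappa>) (at_right 0)"
    using kap by (intro tendsto_intros) auto
  have lim2: "(sqrt \<longlongrightarrow> sqrt 0) (at_right 0)" by (intro tendsto_intros)
  have "eventually (\<lambda>\<eta>. (sqrt \<eta> + \<eta>) / \<kappa> + sqrt \<eta> / sqrt \<kappa> < \<delta>) (at_right 0)"
    using order_tendstoD(2)[OF lim, of \<delta>] \<delta> by simp
  moreover have "eventually (\<lambda>\<eta>. sqrt \<eta> < trunc_mean / (4 * (1 + real p))) (at_right 0)"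
    using order_tendstoD(2)[OF lim2, of "trunc_mean / (4 * (1 + real p))"] trunc_mean_pos by simp
  moreover have "eventually (\<lambda>\<eta>::real. \<eta> > 0) (at_right 0)" by (rule eventually_at_right_less)
  ultimately have "eventually (\<lambda>\<eta>. (sqrt \<eta> + \<eta>) / \<kappa> + sqrt \<eta> / sqrt \<kappa> < \<delta> \<and>
      sqrt \<eta> < trunc_mean / (4 * (1 + real p)) \<and> \<eta> > 0) (at_right 0)"
    by eventually_elim auto
  then have "\<exists>\<eta>. (sqrt \<eta> + \<eta>) / \<kappa> + sqrt \<eta> / sqrt \<kappa> < \<delta> \<and>
      sqrt \<eta> < trunc_mean / (4 * (1 + real p)) \<and> \<eta> > 0"
    by (rule eventually_happens'[rotated]) simp
  then obtain \<eta> where \<eta>: "(sqrt \<eta> + \<eta>) / \<kappa> + sqrt \<eta> / sqrt \<kappa> < \<delta>"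
      "sqrt \<eta> < trunc_mean / (4 * (1 + real p))" "\<eta> > 0"
    by blast
  define t where "t n = sqrt ((\<Sum>j<n. (impulse p (\<lambda>j. \<theta> n $ j) (int j))\<^sup>2) / real n)" for n
  define b where "b n = real p * \<sigma> ^ 4 * (t n)\<^sup>2 + ((real p)\<^sup>2 * \<sigma>\<^sup>2 + real p * \<sigma>\<^sup>2) * t n
       + ((real p)\<^sup>2 * \<sigma>\<^sup>2 + real p + (real p)\<^sup>2 * \<sigma> ^ 4) / real n" for n
  have "t \<longlonglongrightarrow> sqrt 0" unfolding t_def by (intro tendsto_real_sqrt H)
  then have t: "t \<longlonglongrightarrow> 0" by simp
  have "(\<lambda>n. b n / \<eta>) \<longlonglongrightarrow> (real p * \<sigma> ^ 4 * 0\<^sup>2 + ((real p)\<^sup>2 * \<sigma>\<^sup>2 + real p * \<sigma>\<^sup>2) * 0 + 0) / \<eta>"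
    unfolding b_def using \<eta>(3) by (intro tendsto_intros t lim_const_over_n) auto
  then have b: "(\<lambda>n. b n / \<eta>) \<longlonglongrightarrow> 0" by simp
  let ?E = "\<lambda>n. {\<omega> \<in> space M. \<bar>eucl_norm (ols_estimator p (\<lambda>k. X n k \<omega>) n - \<theta> n) - 0\<bar> > \<delta>}"
  have "eventually (\<lambda>n. measure M (?E n) \<le> b n / \<eta>) sequentially"
    using S eventually_ge_at_top[of "max 1 (4 * p)"]
  proof eventually_elim
    case (elim n)
    then have n: "1 \<le> n" "4 * p \<le> n" by auto
    obtain D where D: "integrable M D" "\<And>\<omega>. 0 \<le> D \<omega>" "expectation D \<le> b n"
      and err: "\<And>\<omega> \<eta>. \<omega> \<in> space M \<Longrightarrow> D \<omega> \<le> \<eta> \<Longrightarrow> sqrt \<eta> \<le> trunc_mean / (4 * (1 + real p)) \<Longrightarrow>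
       eucl_norm (ols_estimator p (\<lambda>k. X n k \<omega>) n - \<theta> n) \<le> (sqrt \<eta> + \<eta>) / \<kappa> + sqrt \<eta> / sqrt \<kappa>"
      using ols_error_dominated[OF n elim(1)] unfolding b_def t_def \<kappa>_def by blast
    \<comment> \<open>Only the larger event, described through \<open>D\<close>, has to be shown
      measurable.\<close>
    have "?E n \<subseteq> {\<omega> \<in> space M. D \<omega> \<ge> \<eta>}"
    proof clarsimp
      fix \<omega> assume w: "\<omega> \<in> space M"
        and big: "\<delta> < \<bar>eucl_norm (ols_estimator p (\<lambda>k. X n k \<omega>) n - \<theta> n)\<bar>"
      have "0 \<le> eucl_norm u" for u by (simp add: eucl_norm_def sum_nonneg)
      then show "\<eta> \<le> D \<omega>" using err[OF w, of \<eta>] \<eta>(1,2) big by (cases "\<eta> \<le> D \<omega>") auto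
    qed
    then have "measure M (?E n) \<le> measure M {\<omega> \<in> space M. D \<omega> \<ge> \<eta>}"
      using D(1) by (intro finite_measure_mono) auto
    also have "\<dots> \<le> expectation D / \<eta>"
      using D \<eta>(3) by (intro integral_Markov_inequality_measure[where A = "{}"]) auto
    also have "\<dots> \<le> b n / \<eta>" using D(3) \<eta>(3) by (intro divide_right_mono) auto
    finally show ?case .
  qed
  then show "(\<lambda>n. measure M (?E n)) \<longlonglongrightarrow> 0"
    by (intro tendsto_sandwich[OF _ _ tendsto_const b]) auto
qed

end

section \<open>The limit matrix and the conclusion\<close>

text \<open>Below the first row the entries do not change with \<open>n\<close>, so the limit
  inherits them; the first row converges to the limit coefficients.\<close>

lemma limit_of_companions_is_companion:
  assumes p: "p \<ge> 1" and A: "A \<in> carrier_mat p p"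
    and lim: "mat_tendsto p (\<lambda>n. companion_mat p (\<theta> n)) A"
  shows "A = companion_mat p (vec p (\<lambda>j. A $$ (0, j)))"
    and "j < p \<Longrightarrow> (\<lambda>n. \<theta> n $ j) \<longlonglongrightarrow> A $$ (0, j)"
proof -
  have ij: "(\<lambda>n. companion_mat p (\<theta> n) $$ (i, j)) \<longlonglongrightarrow> A $$ (i, j)" if "i < p" "j < p" for i j
    using lim that by (simp add: mat_tendsto_def)
  show "(\<lambda>n. \<theta> n $ j) \<longlonglongrightarrow> A $$ (0, j)" if "j < p" for j
    using ij[of 0 j] p that by (simp add: companion_mat_def)
  show "A = companion_mat p (vec p (\<lambda>j. A $$ (0, j)))"
  proof (rule eq_matI)
    fix i j assume "i < dim_row (companion_mat p (vec p (\<lambda>j. A $$ (0, j))))"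
      "j < dim_col (companion_mat p (vec p (\<lambda>j. A $$ (0, j))))"
    then have b: "i < p" "j < p" by (auto simp: companion_mat_def)
    show "A $$ (i, j) = companion_mat p (vec p (\<lambda>j. A $$ (0, j))) $$ (i, j)"
    proof (cases "i = 0")
      case False
      then have "(\<lambda>n::nat. if i = j + 1 then 1 else (0::real)) \<longlonglongrightarrow> A $$ (i, j)"
        using ij[OF b] b by (simp add: companion_mat_def)
      then have "A $$ (i, j) = (if i = j + 1 then 1 else 0)"
        by (rule LIMSEQ_unique) (rule tendsto_const)
      then show ?thesis using b False by (simp add: companion_mat_def)
    qed (use b in \<open>simp add: companion_mat_def\<close>)
  qed (use A in \<open>auto simp: companion_mat_def\<close>)
qed

theorem theorem2p3:
  fixes M :: "'w measure"
    and p :: nat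
    and \<theta> :: "nat \<Rightarrow> real vec"
    and \<epsilon> :: "nat \<Rightarrow> 'w \<Rightarrow> real"
    and \<sigma> c :: real
    and X :: "nat \<Rightarrow> int \<Rightarrow> 'w \<Rightarrow> real"
    and A :: "real mat"
    and lam :: "nat \<Rightarrow> complex"
    and v :: "nat \<Rightarrow> real"
  assumes "triangular_ar M p \<theta> \<epsilon> \<sigma> X"
    and "A \<in> carrier_mat p p"
    and "mat_tendsto p (\<lambda>n. companion_mat p (\<theta> n)) A"
    and "sorted_eigenvalues p (complex_mat A) lam"
    and "inj_on lam {1..p}"
    and "0 < cmod (lam p)"
    and "cmod (lam 1) = spectral_radius (complex_mat A)"
    and "spectral_radius (complex_mat A) = 1"
    and "A $$ (0, p - 1) \<noteq> 0"
    and "lam 1 \<in> {-1, 1}"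
    and "p \<ge> 2 \<Longrightarrow> cmod (lam 2) < 1"
    and "c > 0"
    and "filterlim v at_top sequentially"
    and "(\<lambda>n. v n / real n) \<longlonglongrightarrow> 0"
    and "\<And>n. n \<ge> 1 \<Longrightarrow>
           spectral_radius (complex_mat (companion_mat p (\<theta> n))) = 1 - c / v n"
  shows "tendsto_in_prob M
           (\<lambda>n \<omega>. eucl_norm (ols_estimator p (\<lambda>k. X n k \<omega>) n - \<theta> n)) 0"
proof -
  interpret triangular_ar M p \<theta> \<epsilon> \<sigma> X by fact
  note p = p_ge_1
  define \<alpha> where "\<alpha> = vec p (\<lambda>j. A $$ (0, j))"
  note lim = limit_of_companions_is_companion[OF p assms(2,3), folded \<alpha>_def]
  have conv: "(\<lambda>n. \<theta> n $ j) \<longlonglongrightarrow> \<alpha> $ j" if "j < p" for j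
    using lim(2)[OF that] that by (simp add: \<alpha>_def)
  have Ac: "complex_mat A \<in> carrier_mat p p" using assms(2) by simp
  have "poly (ar_poly p (\<lambda>j. \<alpha> $ j)) (lam i) = 0" if "i \<in> {1..p}" for i
  proof -
    have "poly (char_poly (complex_mat A)) (lam i) = 0"
      using assms(4) that by (auto simp: sorted_eigenvalues_def poly_prod)
    then have "eigenvalue (complex_mat (companion_mat p \<alpha>)) (lam i)"
      unfolding eigenvalue_root_char_poly[OF Ac, symmetric] lim(1)[symmetric] .
    then show ?thesis by (simp add: companion_eigenvalue_iff[OF p])
  qed
  then have fact: "ar_poly p (\<lambda>j. \<alpha> $ j) = (\<Prod>i\<in>{1..p}. [:- lam i, 1:])"
    by (intro ar_poly_eq_prod p assms(5))
  \<comment> \<open>The ordering of the eigenvalues passes the strict bound for the second one on to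
    all later ones.\<close>
  have small: "cmod (lam i) < 1" if "i \<in> {2..p}" for i
  proof (cases "i = 2")
    case False
    then have "eigenvalue_ge (lam 2) (lam i)"
      using assms(4) that by (auto simp: sorted_eigenvalues_def)
    then show ?thesis using assms(11) that by (auto simp: eigenvalue_ge_def)
  qed (use assms(11) that in auto)
  have root: "cmod z \<le> 1 - c / v n"
    if "n \<ge> 1" "poly (ar_poly p (\<lambda>j. \<theta> n $ j)) z = 0" for n z
  proof -
    have "eigenvalue (complex_mat (companion_mat p (\<theta> n))) z"
      using that(2) by (simp add: companion_eigenvalue_iff[OF p])
    then have "cmod z \<in> cmod ` spectrum (complex_mat (companion_mat p (\<theta> n)))"
      by (simp add: spectrum_def)
    moreover have "complex_mat (companion_mat p (\<theta> n)) \<in> carrier_mat p p"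
      by (simp add: companion_mat_def)
    ultimately have "cmod z \<le> spectral_radius (complex_mat (companion_mat p (\<theta> n)))"
      using p by (intro spectral_radius_mem_max(2)[of _ p]) auto
    then show ?thesis using assms(15)[OF that(1)] by simp
  qed
  \<comment> \<open>Divergence of \<open>v\<close> gives its sign only eventually, and the spectral
    gap \<open>c / v n\<close> is positive from then on.\<close>
  have vpos: "eventually (\<lambda>n. v n > 0) sequentially"
    using assms(13) by (simp add: filterlim_at_top_dense)
  then have r1: "eventually (\<lambda>n. 1 - c / v n < 1) sequentially"
    by eventually_elim (use assms(12) in simp)
  obtain C where C: "eventually (\<lambda>n. \<forall>N. (\<Sum>j<N. (cmod (fps_nth (inverse (ar_fps p (\<lambda>j. \<theta> n $ j))) j))\<^sup>2)
      \<le> C / (1 - (1 - c / v n))) sequentially"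
    using ar_fps_inverse_square_sum[OF p conv fact small root r1] by blast
  \<comment> \<open>With the gap \<open>c / v n\<close> the square sum of the impulse response is at
    most \<open>C / c * v n\<close>, which is negligible against \<open>n\<close> by the growth
    condition on \<open>v\<close>.\<close>
  have "eventually (\<lambda>n. (\<Sum>j<n. (impulse p (\<lambda>j. \<theta> n $ j) (int j))\<^sup>2) / real n \<le> C / c * (v n / real n)) sequentially"
    using C vpos
  proof eventually_elim
    case (elim n)
    have "(\<Sum>j<n. (impulse p (\<lambda>j. \<theta> n $ j) (int j))\<^sup>2) \<le> C / (1 - (1 - c / v n))"
      using elim(1) by (simp add: impulse_complex)
    also have "\<dots> = C / c * v n" by simp
    finally show ?case using divide_right_mono[of _ "C / c * v n" "real n"] by simp
  qed
  moreover have "eventually (\<lambda>n. 0 \<le> (\<Sum>j<n. (impulse p (\<lambda>j. \<theta> n $ j) (int j))\<^sup>2) / real n) sequentially"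
    by (intro always_eventually allI divide_nonneg_nonneg sum_nonneg) auto
  ultimately have H: "(\<lambda>n. (\<Sum>j<n. (impulse p (\<lambda>j. \<theta> n $ j) (int j))\<^sup>2) / real n) \<longlonglongrightarrow> 0"
    by (rule tendsto_sandwich[OF _ _ tendsto_const tendsto_mult_right_zero[OF assms(14), of "C / c"], rotated])
  have "(\<lambda>n. \<Sum>j<p. (\<theta> n $ j)\<^sup>2) \<longlonglongrightarrow> (\<Sum>j<p. (\<alpha> $ j)\<^sup>2)"
    using conv by (intro tendsto_intros) auto
  then have "eventually (\<lambda>n. (\<Sum>j<p. (\<theta> n $ j)\<^sup>2) < (\<Sum>j<p. (\<alpha> $ j)\<^sup>2) + 1) sequentially"
    by (rule order_tendstoD) simp
  then have "eventually (\<lambda>n. (\<Sum>j<p. (\<theta> n $ j)\<^sup>2) \<le> (\<Sum>j<p. (\<alpha> $ j)\<^sup>2) + 1) sequentially"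
    by eventually_elim simp
  with H show ?thesis by (rule ols_consistent)
qed

end
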